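(* Let $M$ be a correspondence over a unital $C^*$-algebra $A$ such that $M$ is essential as a left $A$-module, let $m$ be a filter in $M$, and let $(X,D,\phi)$ be a scaling function for $m$. Let $(M_\infty,\iota^k)=\varinjlim(M^{\otimes k},T_k)$, where $T_0:A\to M$ is $T_0a=m\cdot a$ and $T_kn=m\otimes n$ for $n\in M^{\otimes k}$, $k\geq 1$. Then there is a Hilbert-module isomorphism $R$ of $M_\infty$ onto $M_\infty\otimes_A M$ such that $R\circ\iota^{k+1}=\iota^k\otimes\mathrm{id}$ for $k\geq 0$, and there is an inner-product preserving map $Q$ of $M_\infty$ into $X$ such that $(Q\circ\iota^0)1=\phi$ and $D\circ Q=(Q\otimes\mathrm{id})\circ R$. The family $$\{V_k:=Q(\iota^k(M^{\otimes k})):k\ge 0\}$$ is a projective multi-resolution analysis for the submodule $Q(M_\infty)$ of $X$, and $V_0$ is the free rank-one $A$-module generated by $\phi$.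
   Context: All Hilbert modules are right Hilbert $A$-modules, with inner product $A$-linear in the second variable. A correspondence over $A$ is a right Hilbert $A$-module $M$ with a left action given by a $*$-homomorphism $A\to\mathcal L(M)$; $M$ is essential as a left module if $1_A\cdot n=n$ for all $n\in M$. $X\otimes_A M$ is the internal (balanced) tensor product with $\langle x\otimes n,y\otimes n'\rangle=\langle n,\langle x,y\rangle\cdot n'\rangle$. $M^{\otimes k}$ is the $k$-fold internal tensor power, with $M^{\otimes 0}:=A$ (i.e. $A_A$, with $\langle a,b\rangle=a^*b$), and $A\otimes_A M^{\otimes k}$ is identified with $M^{\otimes k}$ via $a\otimes n\mapsto a\cdot n$. For inner-product preserving $S$, $S\otimes\mathrm{id}$ is the map with $(S\otimes\mathrm{id})(x\otimes n)=(Sx)\otimes n$. A Hilbert-module isomorphism is a surjective inner-product preserving map. A filter in $M$ is an element $m\in M$ with $\langle m,m\rangle=1_A$. A scaling function for $m$ is a triple $(X,D,\phi)$ consisting of a Hilbert $A$-module $X$, a Hilbert-module isomorphism $D:X\to X\otimes_A M$, and $\phi\in X$ with $\langle\phi,\phi\rangle=1_A$ and $D\phi=\phi\otimes m$. $\varinjlim(X_k,T_k)$, for inner-product preserving $T_k:X_k\to X_{k+1}$, is the Hilbert-module direct limit: the completion $X_\infty$ of the quotient of $\bigsqcup_kX_k$ in which $x\in X_k$ is identified with $T_kx\in X_{k+1}$, with canonical inner-product preserving maps $\iota^k:X_k\to X_\infty$ satisfying $\iota^{k+1}\circ T_k=\iota^k$. The powers of $D$ are $D^0=\mathrm{id}$,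 $D^1=D$, $D^{k+1}=(D\otimes\mathrm{id}_k)\circ D^k:X\to X\otimes_AM^{\otimes(k+1)}$, where $\mathrm{id}_k$ is the identity of $M^{\otimes k}$, and $D^{-k}=(D^k)^{-1}$. A closed submodule $N$ of a Hilbert module $Z$ is complemented if $(p,n)\mapsto p+n$ is an isomorphism of $N\oplus N^\perp$ onto $Z$. That $\{V_k\}$ is a projective multi-resolution analysis for $Q(M_\infty)$ means: (i) $V_0$ is a complemented submodule of $Q(M_\infty)$; (ii) $V_k=D^{-k}(V_0\otimes_AM^{\otimes k})$ for $k\ge0$; (iii) $V_k$ is a complemented submodule of $V_{k+1}$ for $k\ge 0$; (iv) $\bigcup_kV_k$ is dense in $Q(M_\infty)$. "Free rank-one $A$-module generated by $\phi$" means that $a\mapsto\phi\cdot a$ is a Hilbert-module isomorphism of $A_A$ onto $V_0$. *)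

theory Defs
  imports Complex_Main
begin

section \<open>Unital $C^*$-algebras\<close>

text \<open>The zero algebra is not excluded: \<open>1 = 0\<close> is allowed.\<close>

class unital_cstar_algebra = real_normed_algebra + banach + monoid_mult +
  fixes scaleC :: "complex \<Rightarrow> 'a \<Rightarrow> 'a"
    and star :: "'a \<Rightarrow> 'a"
  assumes scaleC_add_right: "scaleC z (x + y) = scaleC z x + scaleC z y"
    and scaleC_add_left: "scaleC (z + w) x = scaleC z x + scaleC w x"
    and scaleC_scaleC: "scaleC z (scaleC w x) = scaleC (z * w) x"
    and scaleC_of_real: "scaleC (complex_of_real r) x = r *\<^sub>R x"
    and mult_scaleC_left: "scaleC z x * y = scaleC z (x * y)"
    and mult_scaleC_right: "x * scaleC z y = scaleC z (x * y)"
    and norm_scaleC: "norm (scaleC z x) = cmod z * norm x"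
    and star_star: "star (star x) = x"
    and star_add: "star (x + y) = star x + star y"
    and star_scaleC: "star (scaleC z x) = scaleC (cnj z) (star x)"
    and star_mult: "star (x * y) = star y * star x"
    and cstar_identity: "norm (star x * x) = (norm x)\<^sup>2"

definition cstar_spectrum :: "'a::unital_cstar_algebra \<Rightarrow> complex set" where
  "cstar_spectrum a =
     {z. \<not> (\<exists>b. (scaleC z 1 - a) * b = 1 \<and> b * (scaleC z 1 - a) = 1)}"

definition cstar_positive :: "'a::unital_cstar_algebra \<Rightarrow> bool" where
  "cstar_positive a \<longleftrightarrow> star a = a \<and> cstar_spectrum a \<subseteq> complex_of_real ` {0..}"


section \<open>Hilbert modules\<close>

text \<open>
  A Hilbert module is carried by a subset of an abelian group; its right action and its inner
  product (linear in the second variable) are only relevant on that subset. Since the algebra is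
  unital, the complex vector space structure is determined by the right action,
  \<open>z x = x \<cdot> (z 1)\<close>, and is not recorded separately.
\<close>

record ('a, 'h) hmod =
  car :: "'h set"
  ract :: "'h \<Rightarrow> 'a \<Rightarrow> 'h"
  ip :: "'h \<Rightarrow> 'h \<Rightarrow> 'a"

definition hnorm :: "('a::unital_cstar_algebra, 'h, 'z) hmod_scheme \<Rightarrow> 'h \<Rightarrow> real" where
  "hnorm H x = sqrt (norm (ip H x x))"

locale hilbert_module =
  fixes H :: "('a::unital_cstar_algebra, 'h::ab_group_add, 'z) hmod_scheme"
  assumes zero_closed: "0 \<in> car H"
    and add_closed: "x \<in> car H \<Longrightarrow> y \<in> car H \<Longrightarrow> x + y \<in> car H"
    and uminus_closed: "x \<in> car H \<Longrightarrow> - x \<in> car H"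
    and ract_closed: "x \<in> car H \<Longrightarrow> ract H x a \<in> car H"
    and ract_add_left: "x \<in> car H \<Longrightarrow> y \<in> car H \<Longrightarrow> ract H (x + y) a = ract H x a + ract H y a"
    and ract_add_right: "x \<in> car H \<Longrightarrow> ract H x (a + b) = ract H x a + ract H x b"
    and ract_mult: "x \<in> car H \<Longrightarrow> ract H x (a * b) = ract H (ract H x a) b"
    and ract_one: "x \<in> car H \<Longrightarrow> ract H x 1 = x"
    and ip_add_right:
      "x \<in> car H \<Longrightarrow> y \<in> car H \<Longrightarrow> y' \<in> car H \<Longrightarrow> ip H x (y + y') = ip H x y + ip H x y'"
    and ip_ract_right: "x \<in> car H \<Longrightarrow> y \<in> car H \<Longrightarrow> ip H x (ract H y a) = ip H x y * a"
    and ip_star: "x \<in> car H \<Longrightarrow> y \<in> car H \<Longrightarrow> star (ip H x y) = ip H y x"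
    and ip_positive: "x \<in> car H \<Longrightarrow> cstar_positive (ip H x x)"
    and ip_definite: "x \<in> car H \<Longrightarrow> ip H x x = 0 \<Longrightarrow> x = 0"
    and complete:
      "(\<And>i. s i \<in> car H) \<Longrightarrow>
       (\<And>e. e > 0 \<Longrightarrow> \<exists>N. \<forall>i\<ge>N. \<forall>j\<ge>N. hnorm H (s i - s j) < e) \<Longrightarrow>
       \<exists>x\<in>car H. (\<lambda>i::nat. hnorm H (s i - x)) \<longlonglongrightarrow> 0"

text \<open>The algebra as a right module over itself.\<close>

definition alg_module :: "('a::unital_cstar_algebra, 'a) hmod" where
  "alg_module = \<lparr>car = UNIV, ract = (*), ip = (\<lambda>a b. star a * b)\<rparr>"

text \<open>Additivity and right linearity need not be demanded, see \<open>ip_preserving_add\<close> and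
  \<open>ip_preserving_ract\<close> below.\<close>

definition ip_preserving ::
  "('a, 'h, 'z) hmod_scheme \<Rightarrow> ('a, 'k, 'w) hmod_scheme \<Rightarrow> ('h \<Rightarrow> 'k) \<Rightarrow> bool" where
  "ip_preserving H K S \<longleftrightarrow>
     (\<forall>x\<in>car H. S x \<in> car K) \<and> (\<forall>x\<in>car H. \<forall>y\<in>car H. ip K (S x) (S y) = ip H x y)"

definition hm_iso ::
  "('a, 'h, 'z) hmod_scheme \<Rightarrow> ('a, 'k, 'w) hmod_scheme \<Rightarrow> ('h \<Rightarrow> 'k) \<Rightarrow> bool" where
  "hm_iso H K S \<longleftrightarrow> ip_preserving H K S \<and> S ` car H = car K"

text \<open>The set of finite right linear combinations.\<close>

definition hspan :: "('a, 'h::comm_monoid_add, 'z) hmod_scheme \<Rightarrow> 'h set \<Rightarrow> 'h set" where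
  "hspan H S = {\<Sum>i<n. ract H (s i) (a i) | (n::nat) s a. \<forall>i<n. s i \<in> S}"

definition hclosure ::
  "('a::unital_cstar_algebra, 'h::ab_group_add, 'z) hmod_scheme \<Rightarrow> 'h set \<Rightarrow> 'h set" where
  "hclosure H S = {x \<in> car H. \<forall>e>0. \<exists>s\<in>S. hnorm H (x - s) < e}"

definition dense_in ::
  "('a::unital_cstar_algebra, 'h::ab_group_add, 'z) hmod_scheme \<Rightarrow> 'h set \<Rightarrow> bool" where
  "dense_in H S \<longleftrightarrow> S \<subseteq> car H \<and> hclosure H S = car H"

definition closed_submodule ::
  "('a::unital_cstar_algebra, 'h::ab_group_add, 'z) hmod_scheme \<Rightarrow> 'h set \<Rightarrow> bool" where
  "closed_submodule H N \<longleftrightarrow>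
     N \<subseteq> car H \<and> 0 \<in> N \<and> (\<forall>x\<in>N. \<forall>y\<in>N. x + y \<in> N) \<and> (\<forall>x\<in>N. \<forall>a. ract H x a \<in> N) \<and>
     hclosure H N \<subseteq> N"

definition perp :: "('a::zero, 'h, 'z) hmod_scheme \<Rightarrow> 'h set \<Rightarrow> 'h set" where
  "perp H N = {x \<in> car H. \<forall>y\<in>N. ip H y x = 0}"

definition direct_sum ::
  "('a::plus, 'h, 'z) hmod_scheme \<Rightarrow> ('a, 'k, 'w) hmod_scheme \<Rightarrow> ('a, 'h \<times> 'k) hmod" where
  "direct_sum H K =
     \<lparr>car = car H \<times> car K,
      ract = (\<lambda>(x, y) a. (ract H x a, ract K y a)),
      ip = (\<lambda>(x, y) (x', y'). ip H x x' + ip K y y')\<rparr>"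

definition complemented ::
  "('a::unital_cstar_algebra, 'h::ab_group_add, 'z) hmod_scheme \<Rightarrow> 'h set \<Rightarrow> bool" where
  "complemented Z N \<longleftrightarrow>
     closed_submodule Z N \<and>
     hm_iso (direct_sum (Z\<lparr>car := N\<rparr>) (Z\<lparr>car := perp Z N\<rparr>)) Z (\<lambda>(p, n). p + n)"


section \<open>Correspondences and internal tensor products\<close>

record ('a, 'h) corr = "('a, 'h) hmod" +
  lact :: "'a \<Rightarrow> 'h \<Rightarrow> 'h"

locale correspondence = hilbert_module M
  for M :: "('a::unital_cstar_algebra, 'h::ab_group_add, 'z) corr_scheme" +
  assumes lact_closed: "x \<in> car M \<Longrightarrow> lact M a x \<in> car M"
    and lact_adjoint:
      "x \<in> car M \<Longrightarrow> y \<in> car M \<Longrightarrow> ip M (lact M a x) y = ip M x (lact M (star a) y)"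
    and lact_add: "x \<in> car M \<Longrightarrow> lact M (a + b) x = lact M a x + lact M b x"
    and lact_scaleC: "x \<in> car M \<Longrightarrow> lact M (scaleC z a) x = ract M (lact M a x) (scaleC z 1)"
    and lact_mult: "x \<in> car M \<Longrightarrow> lact M (a * b) x = lact M a (lact M b x)"

definition essential :: "('a::one, 'h, 'z) corr_scheme \<Rightarrow> bool" where
  "essential M \<longleftrightarrow> (\<forall>n\<in>car M. lact M 1 n = n)"

text \<open>
  \<open>internal_tensor X Y Z t\<close>: the Hilbert module \<open>Z\<close>, with \<open>t x y\<close> in the role of the
  elementary tensor of \<open>x\<close> and \<open>y\<close>, is the internal tensor product of \<open>X\<close> with the correspondence
  \<open>Y\<close>, that is, the Hausdorff completion of the algebraic tensor product for the given inner
  product. Balancedness and biadditivity of \<open>t\<close> follow from the inner product formula, see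
  \<open>internal_tensor_balanced\<close> and \<open>internal_tensor_add_left\<close> below. Internal tensor products are thus only
  specified up to the unique isomorphism matching elementary tensors.
\<close>

definition internal_tensor ::
  "('a::unital_cstar_algebra, 'x, 'z) hmod_scheme \<Rightarrow> ('a, 'y, 'w) corr_scheme \<Rightarrow>
   ('a, 't::ab_group_add, 'v) hmod_scheme \<Rightarrow> ('x \<Rightarrow> 'y \<Rightarrow> 't) \<Rightarrow> bool" where
  "internal_tensor X Y Z t \<longleftrightarrow>
     hilbert_module Z \<and>
     (\<forall>x\<in>car X. \<forall>y\<in>car Y. t x y \<in> car Z) \<and>
     (\<forall>x\<in>car X. \<forall>x'\<in>car X. \<forall>y\<in>car Y. \<forall>y'\<in>car Y.
        ip Z (t x y) (t x' y') = ip Y y (lact Y (ip X x x') y')) \<and>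
     dense_in Z (hspan Z {t x y | x y. x \<in> car X \<and> y \<in> car Y})"

text \<open>
  \<open>tensor_id X E Z s S Z' s'\<close> is the map \<open>S \<otimes> id\<close> from \<open>Z = X \<otimes> E\<close> to \<open>Z' = X' \<otimes> E\<close>, where
  \<open>s\<close> and \<open>s'\<close> form the elementary tensors of \<open>Z\<close> and \<open>Z'\<close>. Elementary tensors having
  dense span, it is unique on the carrier of \<open>Z\<close> (and arbitrary elsewhere).
\<close>

definition tensor_id ::
  "('a, 'x, 'z1) hmod_scheme \<Rightarrow> ('a, 'y, 'z2) hmod_scheme \<Rightarrow>
   ('a, 't, 'z3) hmod_scheme \<Rightarrow> ('x \<Rightarrow> 'y \<Rightarrow> 't) \<Rightarrow> ('x \<Rightarrow> 'x') \<Rightarrow>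
   ('a, 't', 'z4) hmod_scheme \<Rightarrow> ('x' \<Rightarrow> 'y \<Rightarrow> 't') \<Rightarrow> ('t \<Rightarrow> 't')" where
  "tensor_id X E Z s S Z' s' =
     (SOME F. ip_preserving Z Z' F \<and> (\<forall>x\<in>car X. \<forall>n\<in>car E. F (s x n) = s' (S x) n))"


section \<open>Tensor powers\<close>

text \<open>
  The tensor powers of a correspondence \<open>M\<close>. The power \<open>pow k\<close> lives in one type for all \<open>k\<close>, so
  that the identifications of \<open>A\<close> with the power 0 and of \<open>M\<close> with the power 1 are explicit
  maps \<open>scal\<close> and \<open>vec\<close>; \<open>mul k l x y\<close> is the tensor product of \<open>x \<in> pow k\<close> and \<open>y \<in> pow l\<close>,
  formed in \<open>pow (k + l)\<close>.
\<close>

record ('a, 'm, 't) powers =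
  pow :: "nat \<Rightarrow> ('a, 't) corr"
  scal :: "'a \<Rightarrow> 't"
  vec :: "'m \<Rightarrow> 't"
  mul :: "nat \<Rightarrow> nat \<Rightarrow> 't \<Rightarrow> 't \<Rightarrow> 't"

definition tensor_powers ::
  "('a::unital_cstar_algebra, 'm::ab_group_add) corr \<Rightarrow> ('a, 'm, 't::ab_group_add) powers \<Rightarrow> bool"
  where
  "tensor_powers M P \<longleftrightarrow>
     (\<forall>k. correspondence (pow P k)) \<and>
     hm_iso alg_module (pow P 0) (scal P) \<and>
     (\<forall>a b. scal P (a * b) = lact (pow P 0) a (scal P b)) \<and>
     hm_iso M (pow P 1) (vec P) \<and>
     (\<forall>a. \<forall>n\<in>car M. vec P (lact M a n) = lact (pow P 1) a (vec P n)) \<and>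
     (\<forall>k l. internal_tensor (pow P k) (pow P l) (pow P (k + l)) (mul P k l)) \<and>
     (\<forall>k l a. \<forall>x\<in>car (pow P k). \<forall>y\<in>car (pow P l).
        lact (pow P (k + l)) a (mul P k l x y) = mul P k l (lact (pow P k) a x) y) \<and>
     (\<forall>k a. \<forall>x\<in>car (pow P k). mul P 0 k (scal P a) x = lact (pow P k) a x) \<and>
     (\<forall>k a. \<forall>x\<in>car (pow P k). mul P k 0 x (scal P a) = ract (pow P k) x a) \<and>
     (\<forall>k l p. \<forall>x\<in>car (pow P k). \<forall>y\<in>car (pow P l). \<forall>z\<in>car (pow P p).
        mul P (k + l) p (mul P k l x y) z = mul P k (l + p) x (mul P l p y z))"

text \<open>
  The modules \<open>amp k\<close>, the tensor product of \<open>X\<close> with the \<open>k\<close>-th power of \<open>M\<close>. The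
  map \<open>emb\<close> identifies \<open>X\<close> with \<open>amp 0\<close>, and \<open>ten l k\<close> identifies the tensor product of
  \<open>amp l\<close> and \<open>pow k\<close> with \<open>amp (l + k)\<close>.
\<close>

record ('a, 'x, 't, 'y) amplification =
  amp :: "nat \<Rightarrow> ('a, 'y) hmod"
  emb :: "'x \<Rightarrow> 'y"
  ten :: "nat \<Rightarrow> nat \<Rightarrow> 'y \<Rightarrow> 't \<Rightarrow> 'y"

definition tensor_amplification ::
  "('a::unital_cstar_algebra, 'm::ab_group_add, 't::ab_group_add) powers \<Rightarrow>
   ('a, 'x::ab_group_add) hmod \<Rightarrow> ('a, 'x, 't, 'y::ab_group_add) amplification \<Rightarrow> bool" where
  "tensor_amplification P X W \<longleftrightarrow>
     hm_iso X (amp W 0) (emb W) \<and>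
     (\<forall>l k. internal_tensor (amp W l) (pow P k) (amp W (l + k)) (ten W l k)) \<and>
     (\<forall>l a. \<forall>x\<in>car (amp W l). ten W l 0 x (scal P a) = ract (amp W l) x a) \<and>
     (\<forall>l k p. \<forall>x\<in>car (amp W l). \<forall>n\<in>car (pow P k). \<forall>n'\<in>car (pow P p).
        ten W (l + k) p (ten W l k x n) n' = ten W l (k + p) x (mul P k p n n'))"

text \<open>The elementary tensor of \<open>x \<in> X\<close> and \<open>n \<in> pow k\<close>.\<close>

definition elt :: "('a, 'x, 't, 'y) amplification \<Rightarrow> nat \<Rightarrow> 'x \<Rightarrow> 't \<Rightarrow> 'y" where
  "elt W k x n = ten W 0 k (emb W x) n"

text \<open>
  The powers of \<open>D\<close>, from \<open>X\<close> to \<open>amp k\<close>. In the last equation, \<open>ten W 1 (Suc k)\<close> takes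
  \<open>D x \<in> amp 1\<close> and \<open>n\<close> to their tensor product in \<open>amp (Suc (Suc k))\<close>.
\<close>

fun dpow ::
  "('a, 'm, 't) powers \<Rightarrow> ('a, 'x) hmod \<Rightarrow> ('a, 'x, 't, 'y) amplification \<Rightarrow> ('x \<Rightarrow> 'y) \<Rightarrow>
   nat \<Rightarrow> 'x \<Rightarrow> 'y" where
  "dpow P X W D 0 = emb W"
| "dpow P X W D (Suc 0) = D"
| "dpow P X W D (Suc (Suc k)) =
     tensor_id X (pow P (Suc k)) (amp W (Suc k)) (elt W (Suc k)) D
       (amp W (Suc (Suc k))) (ten W 1 (Suc k)) \<circ> dpow P X W D (Suc k)"

text \<open>The submodule \<open>V \<otimes> pow k\<close> of \<open>amp k\<close>, for a closed submodule \<open>V\<close> of \<open>X\<close>.\<close>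

definition sub_tensor ::
  "('a::unital_cstar_algebra, 'm, 't) powers \<Rightarrow> ('a, 'x, 't, 'y::ab_group_add) amplification \<Rightarrow>
   'x set \<Rightarrow> nat \<Rightarrow> 'y set" where
  "sub_tensor P W V k =
     hclosure (amp W k) (hspan (amp W k) {elt W k v n | v n. v \<in> V \<and> n \<in> car (pow P k)})"


section \<open>Filters, scaling functions, direct limits, multi-resolution analyses\<close>

definition filter_in :: "('a::one, 'm, 'z) hmod_scheme \<Rightarrow> 'm \<Rightarrow> bool" where
  "filter_in M m \<longleftrightarrow> m \<in> car M \<and> ip M m m = 1"

definition scaling_function ::
  "('a::unital_cstar_algebra, 'm, 't) powers \<Rightarrow> 'm \<Rightarrow>
   ('a, 'x::ab_group_add) hmod \<Rightarrow> ('a, 'x, 't, 'y) amplification \<Rightarrow>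
   ('x \<Rightarrow> 'y) \<Rightarrow> 'x \<Rightarrow> bool" where
  "scaling_function P m X W D \<phi> \<longleftrightarrow>
     hilbert_module X \<and> hm_iso X (amp W 1) D \<and>
     \<phi> \<in> car X \<and> ip X \<phi> \<phi> = 1 \<and> D \<phi> = elt W 1 \<phi> (vec P m)"

text \<open>
  The completion of the increasing union obtained by identifying \<open>x\<close> with \<open>T k x\<close>, described
  as a complete module together with the canonical dense isometric images of the modules \<open>Xs k\<close>.
\<close>

definition direct_limit ::
  "(nat \<Rightarrow> ('a::unital_cstar_algebra, 't, 'z) hmod_scheme) \<Rightarrow> (nat \<Rightarrow> 't \<Rightarrow> 't) \<Rightarrow>
   ('a, 'l::ab_group_add) hmod \<Rightarrow> (nat \<Rightarrow> 't \<Rightarrow> 'l) \<Rightarrow> bool" where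
  "direct_limit Xs T L \<iota> \<longleftrightarrow>
     hilbert_module L \<and>
     (\<forall>k. ip_preserving (Xs k) L (\<iota> k)) \<and>
     (\<forall>k. \<forall>x\<in>car (Xs k). \<iota> (Suc k) (T k x) = \<iota> k x) \<and>
     dense_in L (\<Union>k. \<iota> k ` car (Xs k))"

definition projective_mra ::
  "('a::unital_cstar_algebra, 'm, 't) powers \<Rightarrow>
   ('a, 'x::ab_group_add) hmod \<Rightarrow> ('a, 'x, 't, 'y::ab_group_add) amplification \<Rightarrow> ('x \<Rightarrow> 'y) \<Rightarrow>
   'x set \<Rightarrow> (nat \<Rightarrow> 'x set) \<Rightarrow> bool" where
  "projective_mra P X W D N V \<longleftrightarrow>
     complemented (X\<lparr>car := N\<rparr>) (V 0) \<and>
     (\<forall>k. V k = inv_into (car X) (dpow P X W D k) ` sub_tensor P W (V 0) k) \<and>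
     (\<forall>k. complemented (X\<lparr>car := V (Suc k)\<rparr>) (V k)) \<and>
     dense_in (X\<lparr>car := N\<rparr>) (\<Union>k. V k)"


section \<open>Properties implied by the inner product\<close>

context hilbert_module
begin

lemma minus_closed: "x \<in> car H \<Longrightarrow> y \<in> car H \<Longrightarrow> x - y \<in> car H"
  using add_closed[of x "- y"] uminus_closed[of y] by simp

lemma ip_minus_right:
  assumes "x \<in> car H" "y \<in> car H" "y' \<in> car H"
  shows "ip H x (y - y') = ip H x y - ip H x y'"
  using ip_add_right[of x "y - y'" y'] minus_closed[of y y'] assms by (simp add: eq_diff_eq)

lemma ip_add_left:
  assumes "x \<in> car H" "x' \<in> car H" "y \<in> car H"
  shows "ip H (x + x') y = ip H x y + ip H x' y"
proof -
  have "ip H (x + x') y = star (ip H y (x + x'))"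
    using assms by (simp add: ip_star add_closed)
  then show ?thesis
    using assms by (simp add: ip_add_right star_add ip_star)
qed

lemma ip_minus_left:
  assumes "x \<in> car H" "x' \<in> car H" "y \<in> car H"
  shows "ip H (x - x') y = ip H x y - ip H x' y"
  using ip_add_left[of "x - x'" x' y] minus_closed[of x x'] assms by (simp add: eq_diff_eq)

lemma ip_ract_left:
  assumes "x \<in> car H" "y \<in> car H"
  shows "ip H (ract H x a) y = star a * ip H x y"
proof -
  have "ip H (ract H x a) y = star (ip H y (ract H x a))"
    using assms by (simp add: ip_star ract_closed)
  then show ?thesis
    using assms by (simp add: ip_ract_right star_mult ip_star)
qed

lemma eq_if_ip_eq:
  assumes "x \<in> car H" "y \<in> car H" "ip H x x = c" "ip H x y = c" "ip H y x = c" "ip H y y = c"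
  shows "x = y"
proof -
  have "ip H (x - y) (x - y) = 0"
    using assms by (simp add: ip_minus_left ip_minus_right minus_closed)
  then show ?thesis
    using ip_definite[of "x - y"] minus_closed assms by simp
qed

end

lemma ip_preserving_ract:
  assumes "hilbert_module H" "hilbert_module K" "ip_preserving H K S" "x \<in> car H"
  shows "S (ract H x a) = ract K (S x) a"
proof -
  interpret H: hilbert_module H by fact
  interpret K: hilbert_module K by fact
  show ?thesis
    by (rule K.eq_if_ip_eq[where c = "star a * ip H x x * a"])
      (use assms in \<open>auto simp: ip_preserving_def H.ip_ract_left H.ip_ract_right K.ip_ract_left
         K.ip_ract_right H.ract_closed K.ract_closed mult.assoc\<close>)
qed

lemma ip_preserving_add:
  assumes "hilbert_module H" "hilbert_module K" "ip_preserving H K S" "x \<in> car H" "y \<in> car H"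
  shows "S (x + y) = S x + S y"
proof -
  interpret H: hilbert_module H by fact
  interpret K: hilbert_module K by fact
  show ?thesis
    by (rule K.eq_if_ip_eq[where c = "ip H (x + y) (x + y)"])
      (use assms in \<open>auto simp: ip_preserving_def H.ip_add_left H.ip_add_right K.ip_add_left
         K.ip_add_right H.add_closed K.add_closed\<close>)
qed

lemma internal_tensor_balanced:
  assumes "hilbert_module X" "correspondence Y" "internal_tensor X Y Z t"
    and "x \<in> car X" "y \<in> car Y"
  shows "t (ract X x a) y = t x (lact Y a y)"
proof -
  interpret X: hilbert_module X by fact
  interpret Y: correspondence Y by fact
  interpret Z: hilbert_module Z using assms by (simp add: internal_tensor_def)
  show ?thesis
    by (rule Z.eq_if_ip_eq[where c = "ip Y y (lact Y (star a) (lact Y (ip X x x) (lact Y a y)))"])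
      (use assms in \<open>auto simp: internal_tensor_def X.ip_ract_left X.ip_ract_right X.ract_closed
         Y.lact_closed Y.lact_mult Y.lact_adjoint\<close>)
qed

lemma internal_tensor_add_left:
  assumes "hilbert_module X" "correspondence Y" "internal_tensor X Y Z t"
    and "x \<in> car X" "x' \<in> car X" "y \<in> car Y"
  shows "t (x + x') y = t x y + t x' y"
proof -
  interpret X: hilbert_module X by fact
  interpret Y: correspondence Y by fact
  interpret Z: hilbert_module Z using assms by (simp add: internal_tensor_def)
  show ?thesis
    by (rule Z.eq_if_ip_eq[where c = "ip Y y (lact Y (ip X (x + x') (x + x')) y)"])
      (use assms in \<open>auto simp: internal_tensor_def X.ip_add_left X.ip_add_right X.add_closed
         Y.lact_closed Y.lact_add Y.ip_add_right Y.add_closed Z.ip_add_left Z.ip_add_right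
         Z.add_closed\<close>)
qed

end

theory Submission
  imports Defs "HOL-Analysis.Elementary_Metric_Spaces"
begin

text \<open>
  Every map in the statement is obtained by extending an isometry from a dense set, so that two
  such maps agree as soon as they agree on elementary tensors. The isomorphism \<open>R\<close> is induced by
  the maps \<open>\<iota>\<^sup>k \<otimes> id\<close>. Tensoring with \<open>\<phi>\<close> gives an isometry from \<open>M\<^sup>\<otimes>\<^sup>k\<close> to \<open>X \<otimes> M\<^sup>\<otimes>\<^sup>k\<close>; composed with
  \<open>D\<^bsup>-k\<^esup>\<close> these isometries are compatible with the maps \<open>T\<^sub>k\<close>, because
  \<open>D \<phi> = \<phi> \<otimes> m\<close>, and induce \<open>Q\<close>. The projections onto the \<open>V\<^sub>k\<close> come from the projections
  \<open>v \<langle>v, \<cdot>\<rangle> \<otimes> id\<close> for \<open>v = m\<close> and \<open>v = \<phi>\<close>.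

  The Cauchy-Schwarz inequality and the contractivity of the left action rest on the norm of a
  self-adjoint element being its spectral radius. This is obtained without complex analysis,
  from square roots of \<open>1 - b\<close> for self-adjoint \<open>b\<close> of norm less than 1.
\<close>

section \<open>Unital $C^*$-algebras\<close>

text \<open>Positivity is the obstacle. The hypotheses give it spectrally, and only for the elements
  \<open>ip H x x\<close>; that \<open>star w * w\<close> is always positive is a deeper fact, and
  it is bypassed. Squares of self-adjoint elements and the symmetric sum
  \<open>star w * w + w * star w\<close> suffice, once positive elements can be added and the norm
  is monotone on them. Two estimates rest on this: Cauchy-Schwarz makes the inner product
  continuous, and contractivity of the left action makes \<open>x \<otimes> n\<close> continuous in
  \<open>x\<close>, so that a generating set of \<open>X\<close> yields one of
  \<open>X \<otimes> E\<close>. The relation between \<open>D\<close>, \<open>Q\<close> and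
  \<open>R\<close> holds because the two constructions work at opposite ends: \<open>T\<close>
  inserts \<open>m\<close> on the left, next to \<open>X\<close>, whereas \<open>R\<close> splits
  off the last factor on the right. Accordingly the powers of \<open>D\<close> are unfolded in two
  ways, with \<open>D \<otimes> id\<close> acting last for the compatibility with \<open>T\<close>,
  and with \<open>D\<close> acting first for the relation with \<open>R\<close>. That both
  unfoldings agree is associativity of the tensor product.\<close>

lemma scaleC_zero_right [simp]: "scaleC z (0 :: 'a::unital_cstar_algebra) = 0"
  using scaleC_add_right[of z "0 :: 'a" 0] by simp

lemma scaleC_minus_right: "scaleC z (- x) = - scaleC z (x :: 'a::unital_cstar_algebra)"
  using scaleC_add_right[of z x "- x"] by (simp add: eq_neg_iff_add_eq_0 add.commute)

lemma scaleC_diff_right: "scaleC z (x - y) = scaleC z x - scaleC z (y :: 'a::unital_cstar_algebra)"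
  using scaleC_add_right[of z x "- y"] by (simp add: scaleC_minus_right)

lemma scaleC_scaleR: "scaleC z (r *\<^sub>R x) = r *\<^sub>R scaleC z (x :: 'a::unital_cstar_algebra)"
  by (metis scaleC_of_real scaleC_scaleC mult.commute)

lemma star_zero [simp]: "star (0 :: 'a::unital_cstar_algebra) = 0"
  using star_add[of "0 :: 'a" 0] by simp

lemma star_one [simp]: "star (1 :: 'a::unital_cstar_algebra) = 1"
  by (metis star_mult star_star mult_1_left mult_1_right)

lemma star_minus: "star (- x) = - star (x :: 'a::unital_cstar_algebra)"
  using star_add[of x "- x"] by (simp add: eq_neg_iff_add_eq_0 add.commute)

lemma star_diff: "star (x - y) = star x - star (y :: 'a::unital_cstar_algebra)"
  using star_add[of x "- y"] by (simp add: star_minus)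

lemma star_scaleR: "star (r *\<^sub>R x) = r *\<^sub>R star (x :: 'a::unital_cstar_algebra)"
  by (metis scaleC_of_real star_scaleC complex_cnj_complex_of_real)

text \<open>The C*-identity bounds the square of \<open>norm y\<close> by
  \<open>norm (star y) * norm y\<close>; cancel one factor and apply the result to \<open>x\<close>
  and to \<open>star x\<close>.\<close>

lemma norm_star [simp]: "norm (star x) = norm (x :: 'a::unital_cstar_algebra)"
proof -
  have le: "norm y \<le> norm (star y)" for y :: 'a
  proof (cases "norm y = 0")
    case False
    have "norm y * norm y \<le> norm (star y) * norm y"
      using norm_mult_ineq[of "star y" y] by (simp add: cstar_identity power2_eq_square)
    then show ?thesis
      using False by simp
  qed simp
  show ?thesis
    using le[of x] le[of "star x"] by (simp add: star_star)
qed

lemma bounded_linear_star: "bounded_linear (star :: 'a::unital_cstar_algebra \<Rightarrow> 'a)"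
  by (rule bounded_linear_intro[where K = 1]) (simp_all add: star_add star_scaleR)

lemma norm_one_le: "norm (1 :: 'a::unital_cstar_algebra) \<le> 1"
proof -
  have "norm (1 :: 'a) = (norm (1 :: 'a))\<^sup>2"
    using cstar_identity[of "1 :: 'a"] by simp
  then have "norm (1 :: 'a) * (norm (1 :: 'a) - 1) = 0"
    by (simp add: power2_eq_square algebra_simps)
  then show ?thesis
    by auto
qed

lemma norm_scaleR_one_le: "norm (r *\<^sub>R (1 :: 'a::unital_cstar_algebra)) \<le> \<bar>r\<bar>"
  using mult_left_le[OF norm_one_le, of "\<bar>r\<bar>"] by simp

section \<open>Invertible elements\<close>

definition has_inverse :: "'a::monoid_mult \<Rightarrow> bool" where
  "has_inverse a \<longleftrightarrow> (\<exists>b. a * b = 1 \<and> b * a = 1)"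

lemma has_inverse_mult:
  assumes "has_inverse a" "has_inverse b"
  shows "has_inverse (a * b)"
proof -
  obtain a' b' where "a * a' = 1" "a' * a = 1" "b * b' = 1" "b' * b = 1"
    using assms by (auto simp: has_inverse_def)
  then have "(a * b) * (b' * a') = 1 \<and> (b' * a') * (a * b) = 1"
    by (metis mult.assoc mult_1_left)
  then show ?thesis
    unfolding has_inverse_def by blast
qed

lemma has_inverse_scaleR:
  fixes a :: "'a::unital_cstar_algebra"
  assumes "has_inverse a" "r \<noteq> 0"
  shows "has_inverse (r *\<^sub>R a)"
proof -
  obtain b where "a * b = 1" "b * a = 1"
    using assms by (auto simp: has_inverse_def)
  then have "(r *\<^sub>R a) * ((1 / r) *\<^sub>R b) = 1 \<and> ((1 / r) *\<^sub>R b) * (r *\<^sub>R a) = 1"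
    using assms by simp
  then show ?thesis
    unfolding has_inverse_def by blast
qed

text \<open>The Neumann series in the guise of fixed points: \<open>y = 1 + x * y\<close> is a right
  inverse, \<open>z = 1 + z * x\<close> a left inverse, and the two coincide by
  associativity.\<close>

lemma has_inverse_one_minus:
  fixes x :: "'a::unital_cstar_algebra"
  assumes "norm x < 1"
  shows "has_inverse (1 - x)"
proof -
  have "\<exists>!y. y \<in> UNIV \<and> 1 + x * y = y"
  proof (rule Banach_fix[where c = "norm x"])
    show "dist (1 + x * y) (1 + x * z) \<le> norm x * dist y z" for y z
      using norm_mult_ineq[of x "y - z"] by (simp add: dist_norm algebra_simps)
  qed (use assms in \<open>auto simp: complete_UNIV\<close>)
  then obtain y where y: "1 + x * y = y"
    by auto
  have "\<exists>!y. y \<in> UNIV \<and> 1 + y * x = y"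
  proof (rule Banach_fix[where c = "norm x"])
    show "dist (1 + y * x) (1 + z * x) \<le> norm x * dist y z" for y z
      using norm_mult_ineq[of "y - z" x] by (simp add: dist_norm algebra_simps)
  qed (use assms in \<open>auto simp: complete_UNIV\<close>)
  then obtain z where z: "1 + z * x = z"
    by auto
  have 1: "(1 - x) * y = 1" and 2: "z * (1 - x) = 1"
    using y z by (simp_all add: algebra_simps)
  then have "z = y"
    by (metis mult.assoc mult_1_left mult_1_right)
  then show ?thesis
    using 1 2 by (auto simp: has_inverse_def)
qed

lemma has_inverse_scaleR_one_minus:
  fixes x :: "'a::unital_cstar_algebra"
  assumes "norm x < r"
  shows "has_inverse (r *\<^sub>R 1 - x)"
proof -
  have "0 < r"
    using assms norm_ge_zero[of x] by linarith
  then have "has_inverse (r *\<^sub>R (1 - (1 / r) *\<^sub>R x))"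
    using assms by (intro has_inverse_scaleR has_inverse_one_minus) auto
  then show ?thesis
    using \<open>0 < r\<close> by (simp add: scaleR_diff_right)
qed

section \<open>Square roots near the identity\<close>

text \<open>The square root is \<open>1 - x\<close>, where \<open>x\<close> is the fixed point of \<open>x \<mapsto> (b + x\<^sup>2) / 2\<close>.\<close>

lemma sqrt_one_minus:
  fixes b :: "'a::unital_cstar_algebra"
  assumes sa: "star b = b" and "norm b < 1"
  obtains h where "star h = h" "h * h = 1 - b" "\<And>y. y * b = b * y \<Longrightarrow> y * h = h * y"
proof -
  define r where "r = norm b"
  \<comment> \<open>Self-adjointness and commutation with everything that commutes with
    \<open>b\<close> are closed conditions, so they are built into the domain of the iteration and
    inherited by the fixed point. The radius \<open>r\<close> is also the contraction
    constant.\<close>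
  define S where "S = cball 0 r \<inter> {x. star x = x} \<inter> (\<Inter>y\<in>{y. y * b = b * y}. {x. y * x = x * y})"
  have r: "0 \<le> r" "r < 1"
    using assms by (auto simp: r_def)
  have S_iff: "x \<in> S \<longleftrightarrow> norm x \<le> r \<and> star x = x \<and> (\<forall>y. y * b = b * y \<longrightarrow> y * x = x * y)" for x
    unfolding S_def by fastforce
  have "closed S"
    unfolding S_def
    by (intro closed_Int closed_cball closed_INT ballI closed_Collect_eq continuous_intros
        bounded_linear.continuous_on[OF bounded_linear_star])
  then have "complete S"
    by (simp add: complete_eq_closed)
  have bound: "norm (x * x') \<le> r * r" if "norm x \<le> r" "norm x' \<le> r" for x x' :: 'a
    using norm_mult_ineq[of x x'] mult_mono[OF that(1) that(2)] r by simp
  have "\<exists>!x. x \<in> S \<and> (1/2) *\<^sub>R (b + x * x) = x"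
  proof (rule Banach_fix[OF \<open>complete S\<close> _ r])
    show "S \<noteq> {}"
      proof -
      have "0 \<in> S"
        using r by (simp add: S_iff)
      then show ?thesis
        by blast
    qed
    show "(\<lambda>x. (1/2) *\<^sub>R (b + x * x)) ` S \<subseteq> S"
    proof clarify
      fix x assume x: "x \<in> S"
      have "norm x \<le> r"
        using x unfolding S_iff by blast
      then have "norm (b + x * x) \<le> r + r * r"
        using norm_triangle_mono[OF _ bound[of x x], of b r] by (simp add: r_def)
      also have "\<dots> \<le> 2 * r"
        using r mult_left_le[of r r] by simp
      finally have "norm ((1/2) *\<^sub>R (b + x * x)) \<le> r"
        by simp
      moreover have "y * (x * x) = (x * x) * y" if "y * b = b * y" for y
      proof -
        have "y * x = x * y"
          using x that unfolding S_iff by blast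
        then show ?thesis
          by (simp add: mult.assoc[symmetric]) (simp add: mult.assoc)
      qed
      moreover have "star x = x"
        using x unfolding S_iff by blast
      ultimately show "(1/2) *\<^sub>R (b + x * x) \<in> S"
        unfolding S_iff using sa by (simp add: star_scaleR star_add star_mult distrib_left distrib_right)
    qed
    show "dist ((1/2) *\<^sub>R (b + x * x)) ((1/2) *\<^sub>R (b + y * y)) \<le> r * dist x y"
      if "x \<in> S" "y \<in> S" for x y
    proof -
      have le: "norm x \<le> r" "norm y \<le> r"
        using that unfolding S_iff by blast+
      \<comment> \<open>This factorization of the difference of squares needs no commutativity. Both
        outer factors have norm at most \<open>r\<close>, and the factor 1/2 compensates for the two
        summands.\<close>
      have "(1/2) *\<^sub>R (b + x * x) - (1/2) *\<^sub>R (b + y * y)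
          = (1/2) *\<^sub>R (x * (x - y) + (x - y) * y)"
        by (simp add: algebra_simps)
      moreover have "norm (x * (x - y) + (x - y) * y) \<le> r * norm (x - y) + norm (x - y) * r"
        by (intro norm_triangle_mono order_trans[OF norm_mult_ineq] mult_mono) (use le r in auto)
      ultimately show ?thesis
        by (simp add: dist_norm)
    qed
  qed
  then obtain x where x: "x \<in> S" "(1/2) *\<^sub>R (b + x * x) = x"
    by auto
  then have eq: "b + x * x = 2 *\<^sub>R x"
    by (metis scaleR_scaleR scaleR_one mult_2 field_sum_of_halves nonzero_mult_div_cancel_left
        times_divide_eq_right zero_neq_numeral mult.right_neutral)
  have "(1 - x) * (1 - x) = 1 - b"
    using eq by (simp add: algebra_simps scaleR_2)
  moreover have "star (1 - x) = 1 - x" "\<And>y. y * b = b * y \<Longrightarrow> y * (1 - x) = (1 - x) * y"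
    using x(1) unfolding S_iff star_diff left_diff_distrib right_diff_distrib
    by (metis star_one mult_1_left mult_1_right)+
  ultimately show thesis
    using that by blast
qed

section \<open>The norm of a self-adjoint element and its spectrum\<close>

lemma scaleC_ii_ii [simp]: "scaleC \<i> (scaleC \<i> x) = - (x :: 'a::unital_cstar_algebra)"
  using scaleC_of_real[of "-1" x] by (simp add: scaleC_scaleC)

lemma scaleC_uminus_ii: "scaleC (- \<i>) x = - scaleC \<i> (x :: 'a::unital_cstar_algebra)"
proof -
  have "scaleC (- \<i>) x + scaleC \<i> x = scaleC (complex_of_real 0) x"
    by (simp add: scaleC_add_left[symmetric])
  then have "scaleC (- \<i>) x + scaleC \<i> x = 0"
    unfolding scaleC_of_real by simp
  then show ?thesis
    by (simp add: eq_neg_iff_add_eq_0)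
qed

text \<open>Replaces the order argument that \<open>a * a\<close> lies below
  \<open>a * a + u * u\<close>. For \<open>v = a + scaleC \<i> u\<close> commutation gives
  \<open>star v * v = a * a + u * u\<close>, and \<open>a\<close> is the real part of
  \<open>v\<close>, so its norm is at most that of \<open>v\<close>.\<close>

lemma norm_squared_le_norm_sum_squares:
  fixes a u :: "'a::unital_cstar_algebra"
  assumes "star a = a" "star u = u" "a * u = u * a"
  shows "(norm a)\<^sup>2 \<le> norm (a * a + u * u)"
proof -
  define v where "v = a + scaleC \<i> u"
  have star_v: "star v = a - scaleC \<i> u"
    using assms by (simp add: v_def star_add star_scaleC scaleC_uminus_ii)
  have vv: "star v * v = a * a + u * u"
    unfolding star_v using assms
    by (simp add: v_def algebra_simps mult_scaleC_left mult_scaleC_right scaleC_diff_right)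
  have "v + star v = a + a"
    by (simp add: v_def[symmetric] star_v) (simp add: v_def)
  then have "norm (2 *\<^sub>R a) \<le> norm v + norm (star v)"
    using norm_triangle_ineq[of v "star v"] by (simp add: scaleR_2)
  then have "norm a \<le> norm v"
    by simp
  then show ?thesis
    using vv cstar_identity[of v] by (metis norm_ge_zero power_mono)
qed

lemma inverse_commute:
  fixes a b g :: "'a::monoid_mult"
  assumes "b * g = 1" "g * b = 1" "a * b = b * a"
  shows "a * g = g * a"
  by (metis assms mult.assoc mult_1_left mult_1_right)

text \<open>
  With \<open>c = a\<^sup>2\<close> and \<open>g = (1 - c)\<^sup>-\<^sup>1\<close>, the element \<open>1 - d - c = (1 - c) (1 - d g)\<close> is, up to
  an arbitrarily small error, the square of a self-adjoint element commuting with \<open>a\<close>.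
\<close>

lemma not_has_inverse_if_norm_one:
  fixes a :: "'a::unital_cstar_algebra"
  assumes sa: "star a = a" and "norm a = 1"
  shows "\<not> has_inverse (1 - a * a)"
proof
  define c where "c = a * a"
  assume "has_inverse (1 - a * a)"
  then obtain g where g: "(1 - c) * g = 1" "g * (1 - c) = 1"
    by (auto simp: has_inverse_def c_def)
  have norm_c: "norm c = 1"
    using cstar_identity[of a] assms by (simp add: c_def)
  have star_c: "star c = c"
    by (simp add: c_def star_mult sa)
  have "star g * (1 - c) = 1"
    using arg_cong[OF g(1), of star] by (simp add: star_mult star_diff star_c)
  then have star_g: "star g = g"
    by (metis g(1) mult.assoc mult_1_left mult_1_right)
  have ac: "a * c = c * a"
    by (simp add: c_def mult.assoc)
  then have ag: "a * g = g * a"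
    by (intro inverse_commute[OF g]) (simp add: algebra_simps)
  have cg: "c * g = g * c"
    by (intro inverse_commute[OF g]) (simp add: algebra_simps)
  \<comment> \<open>Small enough that \<open>1 - d *\<^sub>R g\<close> has a square root, and less
    than 1 so that \<open>1 - d\<close> is a nonnegative bound.\<close>
  define d where "d = 1 / (2 * (norm g + 1))"
  have "0 < 1 / (2 * (G + 1)) \<and> 1 / (2 * (G + 1)) < 1 \<and> 1 / (2 * (G + 1)) * G < 1"
    if "0 \<le> G" for G :: real
    using that by (auto simp: field_simps)
  from this[of "norm g"] have d: "0 < d" "d < 1" "d * norm g < 1"
    by (simp_all add: d_def)
  \<comment> \<open>Since \<open>c\<close> has norm 1, \<open>1 - c\<close> is just out of reach of
    the square root lemma, so \<open>c\<close> is shrunk by the factor \<open>1 - s\<close>. The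
    resulting error has norm at most \<open>2 * s\<close>, which is half of the gain
    \<open>d\<close>; hence the contradiction.\<close>
  define s where "s = d / 4"
  have s: "0 < s" "s < 1"
    using d by (auto simp: s_def)
  have sc: "star ((1 - s) *\<^sub>R c) = (1 - s) *\<^sub>R c" "norm ((1 - s) *\<^sub>R c) < 1"
    using s by (simp_all add: star_scaleR star_c norm_c)
  have dg: "star (d *\<^sub>R g) = d *\<^sub>R g" "norm (d *\<^sub>R g) < 1"
    using d by (simp_all add: star_scaleR star_g)
  obtain h where h: "star h = h" "h * h = 1 - (1 - s) *\<^sub>R c"
    "\<And>y. y * ((1 - s) *\<^sub>R c) = ((1 - s) *\<^sub>R c) * y \<Longrightarrow> y * h = h * y"
    using sqrt_one_minus[OF sc] by blast
  obtain l where l: "star l = l" "l * l = 1 - d *\<^sub>R g"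
    "\<And>y. y * (d *\<^sub>R g) = (d *\<^sub>R g) * y \<Longrightarrow> y * l = l * y"
    using sqrt_one_minus[OF dg] by blast
  \<comment> \<open>\<open>h\<close> and \<open>l\<close> commute with all that commutes with
    \<open>c\<close> and \<open>g\<close> respectively; hence they commute with \<open>a\<close> and
    with each other, and \<open>u\<close> below is self-adjoint.\<close>
  have ah: "a * h = h * a" and gh: "g * h = h * g"
    by (intro h(3); simp add: ac cg)+
  have al: "a * l = l * a" and hl: "h * l = l * h"
    by (intro l(3); simp add: ag gh)+
  define u where "u = h * l"
  have "star u = u"
    by (simp add: u_def star_mult h(1) l(1) hl)
  moreover have "a * u = u * a"
    unfolding u_def by (metis ah al mult.assoc)
  ultimately have "1 \<le> norm (a * a + u * u)"
    using norm_squared_le_norm_sum_squares[of a u] assms by simp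
  also have "a * a + u * u = (1 - d) *\<^sub>R 1 + s *\<^sub>R (c * (1 - d *\<^sub>R g))"
  proof -
    have "u * u = (h * h) * (l * l)"
      unfolding u_def by (metis hl mult.assoc)
    also have "h * h = (1 - c) + s *\<^sub>R c"
      unfolding h(2) by (simp add: algebra_simps)
    also have "((1 - c) + s *\<^sub>R c) * (l * l)
        = (1 - c) - d *\<^sub>R ((1 - c) * g) + s *\<^sub>R (c * (1 - d *\<^sub>R g))"
      unfolding l(2) by (simp add: algebra_simps)
    finally show ?thesis
      unfolding g(1) by (simp add: c_def[symmetric] algebra_simps)
  qed
  also have "norm \<dots> \<le> (1 - d) + s * 2"
  proof (rule norm_triangle_mono)
    show "norm ((1 - d) *\<^sub>R (1::'a)) \<le> 1 - d"
      using norm_scaleR_one_le[of "1 - d"] d by simp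
    have "norm (1 - d *\<^sub>R g) \<le> 1 + d * norm g"
      by (rule norm_triangle_le_diff)
        (use norm_one_le[where 'a = 'a] d in simp)
    then have "norm (1 - d *\<^sub>R g) \<le> 2"
      using d by simp
    then have "norm (c * (1 - d *\<^sub>R g)) \<le> 2"
      using norm_mult_ineq[of c "1 - d *\<^sub>R g"] by (simp add: norm_c)
    then show "norm (s *\<^sub>R (c * (1 - d *\<^sub>R g))) \<le> s * 2"
      using s by simp
  qed
  finally show False
    using d by (simp add: s_def)
qed

text \<open>So \<open>r\<close> or \<open>- r\<close> is a spectral point. After division by
  \<open>r\<close> the product of the two elements is \<open>1 - b * b\<close> with \<open>b\<close>
  of norm 1, and products of invertible elements are invertible.\<close>

lemma not_has_inverse_if_self_adjoint:
  fixes a :: "'a::unital_cstar_algebra"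
  assumes sa: "star a = a" and "norm a = r" and "r > 0"
    and "has_inverse (r *\<^sub>R 1 - a)" "has_inverse (r *\<^sub>R 1 + a)"
  shows False
proof -
  define b where "b = (1 / r) *\<^sub>R a"
  have "has_inverse ((1 / r) *\<^sub>R (r *\<^sub>R 1 - a) * ((1 / r) *\<^sub>R (r *\<^sub>R 1 + a)))"
    by (intro has_inverse_mult has_inverse_scaleR) (use assms in auto)
  also have "(1 / r) *\<^sub>R (r *\<^sub>R 1 - a) * ((1 / r) *\<^sub>R (r *\<^sub>R 1 + a)) = (1 - b) * (1 + b)"
    using assms by (simp only: scaleR_diff_right scaleR_add_right b_def scaleR_scaleR) simp
  also have "\<dots> = 1 - b * b"
    by (simp add: algebra_simps)
  finally show False
    using not_has_inverse_if_norm_one[of b] assms by (simp add: b_def star_scaleR)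
qed

text \<open>
  Positivity in terms of the norm, which makes the sum of positive elements positive without
  spectral theory.
\<close>

definition norm_positive :: "'a::unital_cstar_algebra \<Rightarrow> bool" where
  "norm_positive p \<longleftrightarrow> star p = p \<and> (\<exists>t. norm (t *\<^sub>R 1 - p) \<le> t)"

text \<open>Take \<open>t = norm p\<close> and \<open>a = t *\<^sub>R 1 - p\<close>. If
  \<open>r = norm a\<close> exceeded \<open>t\<close>, then \<open>r - a = (r - t) + p\<close> would
  be invertible since the negative number \<open>t - r\<close> is not in the spectrum of
  \<open>p\<close>, and \<open>r + a = (r + t) - p\<close> since \<open>r + t\<close> exceeds the
  norm of \<open>p\<close>. Neither \<open>r\<close> nor \<open>- r\<close> would then be in the
  spectrum of \<open>a\<close>.\<close>

lemma norm_positive_if_cstar_positive: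
  fixes p :: "'a::unital_cstar_algebra"
  assumes "cstar_positive p"
  shows "norm_positive p"
proof -
  define t where "t = norm p"
  define a where "a = t *\<^sub>R 1 - p"
  have sa: "star p = p" and spec: "cstar_spectrum p \<subseteq> complex_of_real ` {0..}"
    using assms by (auto simp: cstar_positive_def)
  have "norm a \<le> t"
  proof (rule ccontr)
    assume "\<not> norm a \<le> t"
    define r where "r = norm a"
    have r: "r > t" "r > 0"
      using \<open>\<not> norm a \<le> t\<close> norm_ge_zero[of p] by (auto simp: t_def r_def)
    have "complex_of_real (- (r - t)) \<notin> cstar_spectrum p"
      using spec r(1) by (auto simp del: of_real_diff of_real_minus)
    then have "has_inverse (scaleC (complex_of_real (- (r - t))) 1 - p)"
      by (auto simp: cstar_spectrum_def has_inverse_def)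
    then have "has_inverse (- 1 *\<^sub>R ((- (r - t)) *\<^sub>R 1 - p))"
      unfolding scaleC_of_real by (intro has_inverse_scaleR) auto
    then have "has_inverse (r *\<^sub>R 1 - a)"
      by (simp add: a_def algebra_simps)
    moreover have "has_inverse ((r + t) *\<^sub>R 1 - p)"
      using r by (intro has_inverse_scaleR_one_minus) (simp add: t_def)
    then have "has_inverse (r *\<^sub>R 1 + a)"
      by (simp add: a_def algebra_simps)
    moreover have "star a = a"
      by (simp add: a_def star_diff star_scaleR sa)
    ultimately show False
      using not_has_inverse_if_self_adjoint[of a r] r by (simp add: r_def)
  qed
  then show ?thesis
    using sa by (auto simp: norm_positive_def a_def)
qed

lemma norm_positive_add:
  fixes p q :: "'a::unital_cstar_algebra"
  assumes "norm_positive p" "norm_positive q"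
  shows "norm_positive (p + q)"
proof -
  obtain s t where "norm (s *\<^sub>R 1 - p) \<le> s" "norm (t *\<^sub>R 1 - q) \<le> t"
    using assms by (auto simp: norm_positive_def)
  then have "norm ((s *\<^sub>R 1 - p) + (t *\<^sub>R 1 - q)) \<le> s + t"
    by (rule norm_triangle_mono)
  then have "norm ((s + t) *\<^sub>R 1 - (p + q)) \<le> s + t"
    by (simp add: algebra_simps)
  then show ?thesis
    using assms unfolding norm_positive_def by (metis star_add)
qed

lemma norm_positive_scaleR_one_minus:
  fixes p :: "'a::unital_cstar_algebra"
  assumes "star p = p" "norm p \<le> t"
  shows "norm_positive (t *\<^sub>R 1 - p)"
  using assms by (auto simp: norm_positive_def star_diff star_scaleR intro!: exI[of _ t])

lemma norm_positive_scaleR: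
  fixes p :: "'a::unital_cstar_algebra"
  assumes "norm_positive p" "r \<ge> 0"
  shows "norm_positive (r *\<^sub>R p)"
proof -
  obtain t where "norm (t *\<^sub>R 1 - p) \<le> t"
    using assms by (auto simp: norm_positive_def)
  then have "norm (r *\<^sub>R (t *\<^sub>R 1 - p)) \<le> r * t"
    using assms by (simp add: mult_left_mono)
  then have "norm ((r * t) *\<^sub>R 1 - r *\<^sub>R p) \<le> r * t"
    by (simp add: scaleR_diff_right)
  then show ?thesis
    using assms unfolding norm_positive_def by (metis star_scaleR)
qed

text \<open>After scaling to norm less than 1, \<open>1 - k * k\<close> is a square
  \<open>u * u\<close> with \<open>u\<close> commuting with \<open>k\<close>. Its norm is the square
  of \<open>norm u\<close>, which is at most the norm of \<open>u * u + k * k = 1\<close>; so the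
  witness for \<open>k * k\<close> is 1.\<close>

lemma norm_positive_square:
  fixes h :: "'a::unital_cstar_algebra"
  assumes "star h = h"
  shows "norm_positive (h * h)"
proof -
  define r where "r = norm h + 1"
  have r: "r > 0" "norm h < r"
    using norm_ge_zero[of h] by (auto simp: r_def simp del: norm_ge_zero)
  define k where "k = (1 / r) *\<^sub>R h"
  have k: "star k = k" "norm k < 1" "h * h = (r * r) *\<^sub>R (k * k)"
    using assms r by (auto simp: k_def star_scaleR)
  have "norm (k * k) = norm k * norm k"
    using cstar_identity[of k] k by (simp add: power2_eq_square)
  also have "\<dots> < 1"
    using mult_strict_mono'[OF k(2) k(2)] by simp
  finally obtain u where u: "star u = u" "u * u = 1 - k * k"
    "\<And>y. y * (k * k) = (k * k) * y \<Longrightarrow> y * u = u * y"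
    using sqrt_one_minus[of "k * k"] k by (metis star_mult)
  have "k * u = u * k"
    by (rule u(3)) (simp add: mult.assoc)
  then have "(norm u)\<^sup>2 \<le> norm (u * u + k * k)"
    using norm_squared_le_norm_sum_squares[of u k] u(1,2) k(1) by simp
  moreover have "norm (u * u) = (norm u)\<^sup>2"
    using cstar_identity[of u] u(1) by simp
  ultimately have "norm (1 - k * k) \<le> 1"
    using u(2) norm_one_le[where 'a = 'a] by simp
  then have "norm_positive (k * k)"
    using k by (auto simp: norm_positive_def star_mult intro!: exI[of _ 1])
  then show ?thesis
    using k r by (simp add: norm_positive_scaleR)
qed

text \<open>If \<open>n = norm p\<close> exceeded \<open>r\<close>, then
  \<open>n - p = (n - r) + (r - p)\<close> would be a positive scalar plus a positive element, hence
  invertible by the Neumann series. The same holds for \<open>n + p\<close>, so neither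
  \<open>n\<close> nor \<open>- n\<close> would be in the spectrum of \<open>p\<close>.\<close>

lemma norm_le_if_norm_positive:
  fixes p :: "'a::unital_cstar_algebra"
  assumes "norm_positive (r *\<^sub>R 1 - p)" "norm_positive (r *\<^sub>R 1 + p)" "r \<ge> 0"
  shows "norm p \<le> r"
proof (rule ccontr)
  assume "\<not> norm p \<le> r"
  define n where "n = norm p"
  have n: "n > r" "n > 0"
    using \<open>\<not> norm p \<le> r\<close> assms(3) by (auto simp: n_def)
  have "star p = p"
    using assms(1) by (simp add: norm_positive_def star_diff star_scaleR)
  obtain s where "norm (s *\<^sub>R 1 - (r *\<^sub>R 1 - p)) \<le> s"
    using assms(1) by (auto simp: norm_positive_def)
  then have "has_inverse ((n - r + s) *\<^sub>R 1 - (s *\<^sub>R 1 - (r *\<^sub>R 1 - p)))"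
    using n by (intro has_inverse_scaleR_one_minus) simp
  then have 1: "has_inverse (n *\<^sub>R 1 - p)"
    by (simp add: algebra_simps)
  obtain t where "norm (t *\<^sub>R 1 - (r *\<^sub>R 1 + p)) \<le> t"
    using assms(2) by (auto simp: norm_positive_def)
  then have "has_inverse ((n - r + t) *\<^sub>R 1 - (t *\<^sub>R 1 - (r *\<^sub>R 1 + p)))"
    using n by (intro has_inverse_scaleR_one_minus) simp
  then have 2: "has_inverse (n *\<^sub>R 1 + p)"
    by (simp add: algebra_simps)
  show False
    using not_has_inverse_if_self_adjoint[OF \<open>star p = p\<close> _ n(2) 1 2] by (simp add: n_def)
qed

lemma norm_mono_norm_positive:
  fixes p q :: "'a::unital_cstar_algebra"
  assumes "norm_positive p" "norm_positive (q - p)"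
  shows "norm p \<le> norm q"
proof (rule norm_le_if_norm_positive)
  have "star q = q"
    using assms by (simp add: norm_positive_def star_diff)
  then have "norm_positive ((norm q *\<^sub>R 1 - q) + (q - p))"
    by (intro norm_positive_add norm_positive_scaleR_one_minus assms) auto
  then show "norm_positive (norm q *\<^sub>R 1 - p)"
    by simp
  have "norm_positive (norm q *\<^sub>R 1 - 0 :: 'a)"
    by (rule norm_positive_scaleR_one_minus) auto
  then show "norm_positive (norm q *\<^sub>R 1 + p)"
    using norm_positive_add[OF _ assms(1)] by simp
qed simp

text \<open>In the sum the mixed terms cancel: it equals
  \<open>2 *\<^sub>R (h * h) + 2 *\<^sub>R (k * k)\<close>, where \<open>h\<close> is the real part
  of \<open>w\<close> and \<open>k\<close> is minus its imaginary part. This stands in for the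
  positivity of \<open>star w * w\<close>.\<close>

lemma norm_positive_star_mult_add_mult_star:
  fixes w :: "'a::unital_cstar_algebra"
  shows "norm_positive (star w * w + w * star w)"
proof -
  define h k where "h = (1/2) *\<^sub>R (w + star w)" and "k = (1/2) *\<^sub>R scaleC \<i> (w - star w)"
  have "star h = h"
    by (simp add: h_def star_scaleR star_add star_star add.commute)
  moreover have "star k = k"
    unfolding k_def star_scaleR star_scaleC star_diff star_star
    by (simp add: scaleC_uminus_ii flip: scaleC_minus_right)
  ultimately have "norm_positive (2 *\<^sub>R (h * h) + 2 *\<^sub>R (k * k))"
    by (intro norm_positive_add norm_positive_scaleR norm_positive_square) auto
  moreover have "4 *\<^sub>R (h * h) = (w + star w) * (w + star w)"
    by (simp add: h_def)
  moreover have "4 *\<^sub>R (k * k) = - ((w - star w) * (w - star w))"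
    by (simp add: k_def mult_scaleC_left mult_scaleC_right scaleC_scaleR)
  moreover have "2 *\<^sub>R (h * h) + 2 *\<^sub>R (k * k) = (1/2) *\<^sub>R (4 *\<^sub>R (h * h) + 4 *\<^sub>R (k * k))"
    by (simp add: scaleR_add_right)
  ultimately have "norm_positive ((1/2) *\<^sub>R ((w + star w) * (w + star w)
      + - ((w - star w) * (w - star w))))"
    by simp
  also have "(w + star w) * (w + star w) + - ((w - star w) * (w - star w))
      = 2 *\<^sub>R (star w * w + w * star w)"
    by (simp add: algebra_simps scaleR_2)
  finally show ?thesis
    by simp
qed

section \<open>The norm of a Hilbert module\<close>

text \<open>The type of vectors carries no topology, so convergence is relative to the module, and
  membership in the carrier is recorded with it.\<close>

definition hlim ::
  "('a::unital_cstar_algebra, 'h::ab_group_add, 'z) hmod_scheme \<Rightarrow> (nat \<Rightarrow> 'h) \<Rightarrow> 'h \<Rightarrow> bool" where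
  "hlim H s x \<longleftrightarrow> (\<forall>i. s i \<in> car H) \<and> x \<in> car H \<and> (\<lambda>i. hnorm H (s i - x)) \<longlonglongrightarrow> 0"

context hilbert_module
begin

lemma ip_zero_right: "x \<in> car H \<Longrightarrow> ip H x 0 = 0"
  using ip_add_right[of x 0 0] by (simp add: zero_closed)

lemma ip_zero_left: "x \<in> car H \<Longrightarrow> ip H 0 x = 0"
  using ip_add_left[of 0 0 x] by (simp add: zero_closed)

lemma sum_closed: "(\<And>i. i \<in> I \<Longrightarrow> f i \<in> car H) \<Longrightarrow> sum f I \<in> car H"
  by (induction I rule: infinite_finite_induct) (auto intro: zero_closed add_closed)

lemma ip_sum_right:
  "x \<in> car H \<Longrightarrow> (\<And>i. i \<in> I \<Longrightarrow> f i \<in> car H) \<Longrightarrow> ip H x (sum f I) = (\<Sum>i\<in>I. ip H x (f i))"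
  by (induction I rule: infinite_finite_induct) (auto simp: ip_zero_right ip_add_right sum_closed)

lemma ip_sum_left:
  "x \<in> car H \<Longrightarrow> (\<And>i. i \<in> I \<Longrightarrow> f i \<in> car H) \<Longrightarrow> ip H (sum f I) x = (\<Sum>i\<in>I. ip H (f i) x)"
  by (induction I rule: infinite_finite_induct) (auto simp: ip_zero_left ip_add_left sum_closed)

text \<open>Lets the right action stand in for negation, which \<open>closed_submodule\<close> does
  not list among its closure conditions.\<close>

lemma ract_uminus_one:
  assumes "x \<in> car H"
  shows "ract H x (- 1) = - x"
proof -
  have "ract H x 0 = 0"
    using ract_add_right[OF assms, of 0 0] by simp
  then show ?thesis
    using ract_add_right[OF assms, of 1 "- 1"] assms by (simp add: ract_one eq_neg_iff_add_eq_0 add.commute)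
qed

lemma hnorm_ge_zero [simp]: "0 \<le> hnorm H x"
  by (simp add: hnorm_def)

lemma hnorm_squared: "(hnorm H x)\<^sup>2 = norm (ip H x x)"
  by (simp add: hnorm_def)

lemma hnorm_zero [simp]: "hnorm H 0 = 0"
  by (simp add: hnorm_def ip_zero_left zero_closed)

lemma hnorm_eq_zero: "x \<in> car H \<Longrightarrow> hnorm H x = 0 \<longleftrightarrow> x = 0"
  using ip_definite[of x] by (auto simp: hnorm_def ip_zero_left zero_closed)

lemma norm_positive_ip: "x \<in> car H \<Longrightarrow> norm_positive (ip H x x)"
  by (intro norm_positive_if_cstar_positive ip_positive)

text \<open>Expand the positive element \<open>ip H z z\<close> for
  \<open>z = ract H x (t *\<^sub>R w) - y\<close>. The usual argument compares
  \<open>star w * c * w\<close> with a multiple of \<open>star w * w\<close>, which presupposes that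
  \<open>star w * w\<close> is positive; here it is compared with the scalar bound of its norm
  instead.\<close>

lemma norm_positive_ip_bound:
  assumes "x \<in> car H" "y \<in> car H"
  defines "w \<equiv> ip H x y"
  shows "norm_positive ((t\<^sup>2 * (norm w)\<^sup>2 * norm (ip H x x) + norm (ip H y y)) *\<^sub>R 1
           - (2 * t) *\<^sub>R (star w * w))"
proof -
  define c where "c = ip H x x"
  define d where "d = ip H y y"
  define z where "z = ract H x (t *\<^sub>R w) - y"
  have z: "z \<in> car H"
    using assms by (simp add: z_def minus_closed ract_closed)
  have sw: "star w = ip H y x"
    using assms by (simp add: ip_star)
  have sa: "star c = c" "star d = d"
    using assms by (simp_all add: c_def d_def ip_star)
  have "ip H z z = t\<^sup>2 *\<^sub>R (star w * c * w) - (2 * t) *\<^sub>R (star w * w) + d"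
    using assms(1,2)
    by (simp add: z_def ip_minus_left ip_minus_right ip_ract_left ip_ract_right ract_closed minus_closed
        c_def[symmetric] d_def[symmetric] w_def[symmetric] sw[symmetric] star_scaleR algebra_simps power2_eq_square
        scaleR_2[symmetric] flip: scaleR_add_left)
  moreover have "norm_positive ((t\<^sup>2 * (norm w)\<^sup>2 * norm c) *\<^sub>R 1 - t\<^sup>2 *\<^sub>R (star w * c * w))"
  proof (rule norm_positive_scaleR_one_minus)
    have "norm (star w * c * w) \<le> norm w * norm c * norm w"
      by (intro order_trans[OF norm_mult_ineq] mult_mono) (auto intro: order_trans[OF norm_mult_ineq])
    then have "t\<^sup>2 * norm (star w * c * w) \<le> t\<^sup>2 * (norm w * norm c * norm w)"
      by (rule mult_left_mono) simp
    then show "norm (t\<^sup>2 *\<^sub>R (star w * c * w)) \<le> t\<^sup>2 * (norm w)\<^sup>2 * norm c"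
      by (simp add: power2_eq_square mult_ac)
  qed (simp add: star_scaleR star_mult star_star sa mult.assoc)
  moreover have "norm_positive (norm d *\<^sub>R 1 - d)"
    using sa by (intro norm_positive_scaleR_one_minus) auto
  ultimately have "norm_positive ((t\<^sup>2 *\<^sub>R (star w * c * w) - (2 * t) *\<^sub>R (star w * w) + d)
      + (((t\<^sup>2 * (norm w)\<^sup>2 * norm c) *\<^sub>R 1 - t\<^sup>2 *\<^sub>R (star w * c * w)) + (norm d *\<^sub>R 1 - d)))"
    using norm_positive_ip[OF z] by (metis norm_positive_add)
  then show ?thesis
    unfolding c_def[symmetric] d_def[symmetric] by (simp add: scaleR_add_left algebra_simps)
qed

text \<open>
  \<open>w\<^sup>* w\<close> is bounded above by \<open>norm_positive_ip_bound\<close>, and below since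
  \<open>w\<^sup>* w + w w\<^sup>*\<close> is positive and \<open>w w\<^sup>*\<close> is bounded above in the same way.
\<close>

lemma norm_ip_le:
  assumes xy: "x \<in> car H" "y \<in> car H"
  shows "norm (ip H x y) \<le> hnorm H x * hnorm H y"
proof (cases "x = 0 \<or> y = 0")
  case True
  then show ?thesis
    using xy by (auto simp: ip_zero_left ip_zero_right)
next
  case False
  have bound: "norm_positive ((((norm (ip H x y))\<^sup>2 + norm (ip H x x) * norm (ip H y y)) / 2) *\<^sub>R 1
      - star (ip H x y) * ip H x y)"
    if "x \<in> car H" "y \<in> car H" "x \<noteq> 0" for x y
  proof -
    define c where "c = norm (ip H x x)"
    have "c > 0"
      using that ip_definite by (auto simp: c_def)
    \<comment> \<open>The choice \<open>t = 1 / c\<close> balances the two terms; the factor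
      \<open>c / 2\<close> then normalizes the coefficient of the subtracted square to 1.\<close>
    have "norm_positive ((c / 2) *\<^sub>R (((1 / c)\<^sup>2 * (norm (ip H x y))\<^sup>2 * c + norm (ip H y y)) *\<^sub>R 1
        - (2 * (1 / c)) *\<^sub>R (star (ip H x y) * ip H x y)))"
      using norm_positive_ip_bound[OF that(1,2), of "1 / c"] \<open>c > 0\<close>
      unfolding c_def[symmetric] by (intro norm_positive_scaleR) auto
    moreover have "(c / 2) * ((1 / c)\<^sup>2 * (norm (ip H x y))\<^sup>2 * c + norm (ip H y y))
        = ((norm (ip H x y))\<^sup>2 + c * norm (ip H y y)) / 2"
      using \<open>c > 0\<close> by (simp add: field_simps power2_eq_square)
    ultimately show ?thesis
      using \<open>c > 0\<close> unfolding c_def[symmetric] by (simp add: scaleR_diff_right)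
  qed
  define w where "w = ip H x y"
  \<comment> \<open>The bound still contains the quantity to be estimated, but only with weight one
    half, so it can be absorbed at the end.\<close>
  define r where "r = ((norm w)\<^sup>2 + norm (ip H x x) * norm (ip H y y)) / 2"
  have sw: "star w = ip H y x"
    using xy by (simp add: w_def ip_star)
  have 1: "norm_positive (r *\<^sub>R 1 - star w * w)"
    using bound[OF xy] False by (simp add: w_def r_def)
  have "norm_positive (r *\<^sub>R 1 - w * star w)"
    using bound[OF xy(2,1)] False norm_star[of w] by (simp add: sw[symmetric] r_def star_star mult.commute)
  then have "norm_positive ((r *\<^sub>R 1 - w * star w) + (star w * w + w * star w))"
    by (intro norm_positive_add norm_positive_star_mult_add_mult_star)
  then have "norm_positive (r *\<^sub>R 1 + star w * w)"
    by (simp add: algebra_simps)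
  then have "norm (star w * w) \<le> r"
    using 1 by (intro norm_le_if_norm_positive) (auto simp: r_def)
  then have "(norm w)\<^sup>2 \<le> (hnorm H x * hnorm H y)\<^sup>2"
    by (simp add: cstar_identity r_def power_mult_distrib hnorm_squared)
  then show ?thesis
    unfolding w_def by (rule power2_le_imp_le) simp
qed

lemma hnorm_triangle:
  assumes "x \<in> car H" "y \<in> car H"
  shows "hnorm H (x + y) \<le> hnorm H x + hnorm H y"
proof (rule power2_le_imp_le)
  have "(hnorm H (x + y))\<^sup>2 = norm ((ip H x x + ip H x y) + (ip H y x + ip H y y))"
    using assms by (simp add: hnorm_squared ip_add_left ip_add_right add_closed algebra_simps)
  also have "\<dots> \<le> ((hnorm H x)\<^sup>2 + hnorm H x * hnorm H y) + (hnorm H y * hnorm H x + (hnorm H y)\<^sup>2)"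
    by (intro norm_triangle_mono norm_ip_le) (use assms in \<open>auto simp: hnorm_squared\<close>)
  finally show "(hnorm H (x + y))\<^sup>2 \<le> (hnorm H x + hnorm H y)\<^sup>2"
    by (simp add: power2_eq_square algebra_simps)
qed simp

lemma hnorm_minus:
  assumes "x \<in> car H"
  shows "hnorm H (- x) = hnorm H x"
proof -
  have "ip H (0 - x) (0 - x) = ip H x x"
    using assms by (simp only: ip_minus_left ip_minus_right zero_closed minus_closed)
      (simp add: ip_zero_left ip_zero_right zero_closed)
  then show ?thesis
    by (simp add: hnorm_def)
qed

lemma hnorm_minus_commute: "x \<in> car H \<Longrightarrow> y \<in> car H \<Longrightarrow> hnorm H (x - y) = hnorm H (y - x)"
  using hnorm_minus[of "x - y"] by (simp add: minus_closed)

lemma hnorm_triangle_minus: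
  assumes "x \<in> car H" "y \<in> car H" "z \<in> car H"
  shows "hnorm H (x - z) \<le> hnorm H (x - y) + hnorm H (y - z)"
  using hnorm_triangle[of "x - y" "y - z"] assms by (simp add: minus_closed)

lemma hnorm_ract:
  assumes "x \<in> car H"
  shows "hnorm H (ract H x a) \<le> hnorm H x * norm a"
proof (rule power2_le_imp_le)
  have "(hnorm H (ract H x a))\<^sup>2 = norm (star a * ip H x x * a)"
    using assms by (simp add: hnorm_squared ip_ract_left ip_ract_right ract_closed mult.assoc)
  also have "\<dots> \<le> norm (star a) * norm (ip H x x) * norm a"
    by (intro order_trans[OF norm_mult_ineq] mult_mono norm_mult_ineq) auto
  finally show "(hnorm H (ract H x a))\<^sup>2 \<le> (hnorm H x * norm a)\<^sup>2"
    by (simp add: hnorm_squared[symmetric] power2_eq_square mult_ac)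
qed simp

section \<open>Convergence and closures\<close>

lemma hlimD: "hlim H s x \<Longrightarrow> s i \<in> car H" "hlim H s x \<Longrightarrow> x \<in> car H"
  by (auto simp: hlim_def)

lemma hlim_const: "x \<in> car H \<Longrightarrow> hlim H (\<lambda>i. x) x"
  by (simp add: hlim_def)

lemma hlim_comparison:
  assumes "\<And>i. s i \<in> car H" "x \<in> car H"
    and "\<And>i. hnorm H (s i - x) \<le> c i" "c \<longlonglongrightarrow> 0"
  shows "hlim H s x"
  unfolding hlim_def
  by (intro conjI allI assms(1,2) tendsto_sandwich[OF _ _ tendsto_const assms(4)]) (use assms in auto)

lemma hlim_add:
  assumes "hlim H s x" "hlim H t y"
  shows "hlim H (\<lambda>i. s i + t i) (x + y)"
proof (rule hlim_comparison)
  show "hnorm H (s i + t i - (x + y)) \<le> hnorm H (s i - x) + hnorm H (t i - y)" for i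
    using hnorm_triangle[of "s i - x" "t i - y"] assms hlimD by (simp add: minus_closed algebra_simps)
  show "(\<lambda>i. hnorm H (s i - x) + hnorm H (t i - y)) \<longlonglongrightarrow> 0"
    using assms by (auto simp: hlim_def intro: tendsto_add_zero)
qed (use assms hlimD add_closed in auto)

lemma ract_minus_left:
  assumes "x \<in> car H" "y \<in> car H"
  shows "ract H (x - y) a = ract H x a - ract H y a"
  using ract_add_left[of "x - y" y a] assms by (simp add: minus_closed)

lemma hlim_ract:
  assumes "hlim H s x"
  shows "hlim H (\<lambda>i. ract H (s i) a) (ract H x a)"
proof (rule hlim_comparison)
  show "hnorm H (ract H (s i) a - ract H x a) \<le> hnorm H (s i - x) * norm a" for i
    using hnorm_ract[of "s i - x" a] assms hlimD by (simp add: minus_closed ract_minus_left)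
  show "(\<lambda>i. hnorm H (s i - x) * norm a) \<longlonglongrightarrow> 0"
    using assms by (auto simp: hlim_def intro: tendsto_mult_left_zero)
qed (use assms hlimD ract_closed in auto)

lemma hlim_diff:
  assumes "hlim H s x" "hlim H t y"
  shows "hlim H (\<lambda>i. s i - t i) (x - y)"
  using hlim_add[OF assms(1) hlim_ract[OF assms(2), of "- 1"]] hlimD[OF assms(2)]
  by (simp add: ract_uminus_one)

lemma hlim_unique:
  assumes "hlim H s x" "hlim H s y"
  shows "x = y"
proof -
  have "hlim H (\<lambda>i. 0) (x - y)"
    using hlim_diff[OF assms] by simp
  then have "hnorm H (x - y) = 0"
    using hnorm_minus[of "x - y"] by (auto simp: hlim_def LIMSEQ_const_iff)
  then show ?thesis
    using assms hnorm_eq_zero[of "x - y"] by (auto simp: minus_closed hlim_def)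
qed

lemma hlim_Cauchy:
  assumes "hlim H s x" "e > 0"
  shows "\<exists>N. \<forall>i\<ge>N. \<forall>j\<ge>N. hnorm H (s i - s j) < e"
proof -
  obtain N where N: "\<And>i. i \<ge> N \<Longrightarrow> hnorm H (s i - x) < e / 2"
    using assms LIMSEQ_D[of "\<lambda>i. hnorm H (s i - x)" 0 "e / 2"] by (auto simp: hlim_def)
  have "hnorm H (s i - s j) < e" if "i \<ge> N" "j \<ge> N" for i j
    using N[OF that(1)] N[OF that(2)] hnorm_triangle_minus[of "s i" x "s j"]
      hnorm_minus_commute[of "s j" x] hlimD[OF assms(1)] by simp
  then show ?thesis
    by blast
qed

lemma hlim_complete:
  assumes "\<And>i. s i \<in> car H" "\<And>e. e > 0 \<Longrightarrow> \<exists>N. \<forall>i\<ge>N. \<forall>j\<ge>N. hnorm H (s i - s j) < e"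
  obtains x where "hlim H s x"
  using complete[of s] assms by (auto simp: hlim_def)

lemma hlim_ip:
  assumes "hlim H s x" "hlim H t y"
  shows "(\<lambda>i. ip H (s i) (t i)) \<longlonglongrightarrow> ip H x y"
proof (rule LIM_zero_cancel)
  have bound: "norm (ip H (s i) (t i) - ip H x y)
      \<le> hnorm H (s i - x) * (hnorm H (t i - y) + hnorm H y) + hnorm H x * hnorm H (t i - y)" for i
  proof -
    have c: "s i \<in> car H" "t i \<in> car H" "x \<in> car H" "y \<in> car H"
      using assms hlimD by auto
    have "ip H (s i) (t i) - ip H x y = ip H (s i - x) (t i) + ip H x (t i - y)"
      using c by (simp add: ip_minus_left ip_minus_right minus_closed)
    moreover have "norm (ip H (s i - x) (t i)) \<le> hnorm H (s i - x) * hnorm H (t i)"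
      using c by (simp add: norm_ip_le minus_closed)
    moreover have "\<dots> \<le> hnorm H (s i - x) * (hnorm H (t i - y) + hnorm H y)"
      using hnorm_triangle[of "t i - y" y] c by (intro mult_left_mono) (auto simp: minus_closed)
    moreover have "norm (ip H x (t i - y)) \<le> hnorm H x * hnorm H (t i - y)"
      using c by (simp add: norm_ip_le minus_closed)
    ultimately show ?thesis
      using norm_triangle_mono by (metis order_trans)
  qed
  have "(\<lambda>i. hnorm H (s i - x) * (hnorm H (t i - y) + hnorm H y) + hnorm H x * hnorm H (t i - y))
      \<longlonglongrightarrow> 0 * (0 + hnorm H y) + hnorm H x * 0"
    using assms by (intro tendsto_intros) (auto simp: hlim_def)
  then have upper: "(\<lambda>i. hnorm H (s i - x) * (hnorm H (t i - y) + hnorm H y)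
      + hnorm H x * hnorm H (t i - y)) \<longlonglongrightarrow> 0"
    by simp
  have "(\<lambda>i. norm (ip H (s i) (t i) - ip H x y)) \<longlonglongrightarrow> 0"
    by (rule tendsto_sandwich[OF always_eventually[OF allI] always_eventually[OF allI] tendsto_const upper])
      (rule norm_ge_zero bound)+
  then show "(\<lambda>i. ip H (s i) (t i) - ip H x y) \<longlonglongrightarrow> 0"
    by (rule tendsto_norm_zero_cancel)
qed

lemma hclosure_iff_hlim:
  assumes "S \<subseteq> car H"
  shows "x \<in> hclosure H S \<longleftrightarrow> (\<exists>s. (\<forall>i. s i \<in> S) \<and> hlim H s x)"
proof
  assume x: "x \<in> hclosure H S"
  then have "\<forall>i. \<exists>y\<in>S. hnorm H (x - y) < inverse (real (Suc i))"
    by (simp add: hclosure_def)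
  then obtain s where s: "\<And>i. s i \<in> S" "\<And>i. hnorm H (x - s i) < inverse (real (Suc i))"
    by metis
  have "hlim H s x"
  proof (rule hlim_comparison[OF _ _ _ LIMSEQ_inverse_real_of_nat])
    show "hnorm H (s i - x) \<le> inverse (real (Suc i))" for i
      using s(2)[of i] hnorm_minus_commute[of x "s i"] s(1)[of i] x assms
      by (auto simp: hclosure_def)
  qed (use s x assms in \<open>auto simp: hclosure_def\<close>)
  then show "\<exists>s. (\<forall>i. s i \<in> S) \<and> hlim H s x"
    using s by blast
next
  assume "\<exists>s. (\<forall>i. s i \<in> S) \<and> hlim H s x"
  then obtain s where s: "\<And>i. s i \<in> S" "hlim H s x"
    by blast
  have "\<exists>y\<in>S. hnorm H (x - y) < e" if "e > 0" for e
  proof -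
    obtain i where "hnorm H (s i - x) < e"
      using s(2) \<open>e > 0\<close> LIMSEQ_D[of "\<lambda>i. hnorm H (s i - x)" 0 e] by (auto simp: hlim_def)
    then have "hnorm H (x - s i) < e"
      using hnorm_minus_commute[of x "s i"] hlimD[OF s(2)] by simp
    then show ?thesis
      using s(1) by blast
  qed
  then show "x \<in> hclosure H S"
    using s by (auto simp: hclosure_def hlim_def)
qed

lemma subset_hclosure: "S \<subseteq> car H \<Longrightarrow> S \<subseteq> hclosure H S"
  by (auto simp: hclosure_def intro!: bexI)

lemma subset_hspan:
  assumes "S \<subseteq> car H"
  shows "S \<subseteq> hspan H S"
proof
  fix x assume "x \<in> S"
  then have "x = (\<Sum>i<1::nat. ract H x 1)" "x \<in> S"
    using assms by (auto simp: ract_one)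
  then show "x \<in> hspan H S"
    unfolding hspan_def by fast
qed

lemma hspan_subset_car: "S \<subseteq> car H \<Longrightarrow> hspan H S \<subseteq> car H"
  by (auto simp: hspan_def intro!: sum_closed ract_closed)

section \<open>Closed submodules and complements\<close>

lemma closed_submoduleI:
  assumes "N \<subseteq> car H" "0 \<in> N" "\<And>x y. x \<in> N \<Longrightarrow> y \<in> N \<Longrightarrow> x + y \<in> N"
    and "\<And>x a. x \<in> N \<Longrightarrow> ract H x a \<in> N"
    and "\<And>s x. (\<And>i. s i \<in> N) \<Longrightarrow> hlim H s x \<Longrightarrow> x \<in> N"
  shows "closed_submodule H N"
  unfolding closed_submodule_def
proof (intro conjI ballI allI subsetI)
  show "x \<in> N" if "x \<in> hclosure H N" for x
    using that assms(1) assms(5)[of _ x] by (auto simp: hclosure_iff_hlim)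
qed (use assms in auto)

lemma closed_submodule_hlim:
  assumes "closed_submodule H N" "\<And>i. s i \<in> N" "hlim H s x"
  shows "x \<in> N"
  using assms unfolding closed_submodule_def by (metis hclosure_iff_hlim subsetD)

lemma closed_submodule_uminus:
  assumes "closed_submodule H N" "x \<in> N"
  shows "- x \<in> N"
  using assms ract_uminus_one[of x] unfolding closed_submodule_def by (metis subsetD)

lemma hspan_subset:
  assumes "closed_submodule H N" "S \<subseteq> N"
  shows "hspan H S \<subseteq> N"
proof -
  have "sum f I \<in> N" if "\<And>i. i \<in> I \<Longrightarrow> f i \<in> N" for f :: "nat \<Rightarrow> 'h" and I
    using that assms(1)
    by (induction I rule: infinite_finite_induct) (auto simp: closed_submodule_def)
  moreover have "ract H x a \<in> N" if "x \<in> S" for x a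
    using that assms by (auto simp: closed_submodule_def)
  ultimately show ?thesis
    unfolding hspan_def by fastforce
qed

lemma hclosure_hspan_subset:
  assumes "closed_submodule H N" "S \<subseteq> N"
  shows "hclosure H (hspan H S) \<subseteq> N"
proof -
  have "hclosure H (hspan H S) \<subseteq> hclosure H N"
    using hspan_subset[OF assms] by (fastforce simp: hclosure_def)
  then show ?thesis
    using assms(1) by (auto simp: closed_submodule_def)
qed

lemma hilbert_module_restrict:
  assumes N: "closed_submodule H N"
  shows "hilbert_module (H\<lparr>car := N\<rparr>)"
proof
  have sub: "x \<in> N \<Longrightarrow> x \<in> car H" for x
    using N by (auto simp: closed_submodule_def)
  show "\<exists>x\<in>car (H\<lparr>car := N\<rparr>). (\<lambda>i. hnorm (H\<lparr>car := N\<rparr>) (s i - x)) \<longlonglongrightarrow> 0"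
    if s: "\<And>i. s i \<in> car (H\<lparr>car := N\<rparr>)"
      and C: "\<And>e. e > 0 \<Longrightarrow> \<exists>N'. \<forall>i\<ge>N'. \<forall>j\<ge>N'. hnorm (H\<lparr>car := N\<rparr>) (s i - s j) < e"
    for s :: "nat \<Rightarrow> 'h"
  proof -
    obtain x where "hlim H s x"
      using hlim_complete[of s] s C sub by (auto simp: hnorm_def)
    then show ?thesis
      using closed_submodule_hlim[OF N] s by (auto simp: hnorm_def hlim_def)
  qed
qed (use N closed_submodule_uminus[OF N] in \<open>auto simp: closed_submodule_def subset_iff ract_add_left ract_add_right
    ract_mult ract_one ip_add_right ip_ract_right ip_star ip_positive ip_definite\<close>)

lemma closed_submodule_perp:
  assumes "N \<subseteq> car H"
  shows "closed_submodule H (perp H N)"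
proof (rule closed_submoduleI)
  show "x \<in> perp H N" if "\<And>i. s i \<in> perp H N" "hlim H s x" for s x
  proof -
    have "ip H y x = 0" if "y \<in> N" for y
    proof -
      have "(\<lambda>i. ip H y (s i)) \<longlonglongrightarrow> ip H y x"
        using that assms by (intro hlim_ip hlim_const \<open>hlim H s x\<close>) auto
      then show ?thesis
        using that \<open>\<And>i. s i \<in> perp H N\<close> by (simp add: perp_def LIMSEQ_const_iff)
    qed
    then show ?thesis
      using that(2) by (simp add: perp_def hlim_def)
  qed
qed (use assms in \<open>auto simp: perp_def zero_closed add_closed ract_closed ip_zero_right ip_add_right
    ip_ract_right subset_iff\<close>)

text \<open>Pythagoras holds for the inner products with values in the algebra; passing to norms
  uses that the norm is monotone on positive elements.\<close>

lemma hnorm_le_orthogonal_sum: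
  assumes "p \<in> car H" "n \<in> car H" "ip H p n = 0"
  shows "hnorm H p \<le> hnorm H (p + n)"
proof -
  have "ip H n p = 0"
    using assms ip_star[of p n] by simp
  then have "ip H (p + n) (p + n) - ip H p p = ip H n n"
    using assms by (simp add: ip_add_left ip_add_right add_closed)
  then have "norm (ip H p p) \<le> norm (ip H (p + n) (p + n))"
    using assms by (intro norm_mono_norm_positive) (simp_all add: norm_positive_ip)
  then show ?thesis
    by (simp add: hnorm_def)
qed

text \<open>Because of this, a decomposition needs to be found only on a generating set. Along a
  convergent sequence the components in \<open>N\<close> are Cauchy, since taking this component
  does not increase the norm.\<close>

lemma closed_submodule_orthogonal_sum:
  assumes N: "closed_submodule H N"
  shows "closed_submodule H {p + n | p n. p \<in> N \<and> n \<in> perp H N}" (is "closed_submodule H ?S")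
proof (rule closed_submoduleI)
  have sub: "N \<subseteq> car H"
    using N by (simp add: closed_submodule_def)
  have perp: "closed_submodule H (perp H N)"
    by (rule closed_submodule_perp[OF sub])
  show "?S \<subseteq> car H"
    using sub by (auto simp: perp_def intro: add_closed)
  show "0 \<in> ?S"
    using N perp unfolding closed_submodule_def by (metis (mono_tags, lifting) add_0 mem_Collect_eq)
  show "x + y \<in> ?S" if xy: "x \<in> ?S" "y \<in> ?S" for x y
  proof -
    obtain p n p' n' where *: "x = p + n" "y = p' + n'" "p \<in> N" "n \<in> perp H N" "p' \<in> N" "n' \<in> perp H N"
      using xy by blast
    have "x + y = (p + p') + (n + n')"
      using * by (simp add: algebra_simps)
    then show ?thesis
      using * N perp unfolding closed_submodule_def by blast
  qed
  show "ract H x a \<in> ?S" if x: "x \<in> ?S" for x a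
  proof -
    obtain p n where *: "x = p + n" "p \<in> N" "n \<in> perp H N"
      using x by blast
    then have "ract H x a = ract H p a + ract H n a"
      using sub by (auto intro!: ract_add_left simp: perp_def)
    then show ?thesis
      using * N perp unfolding closed_submodule_def by blast
  qed
  show "x \<in> ?S" if s: "\<And>i. s i \<in> ?S" and lim: "hlim H s x" for s x
  proof -
    have "\<forall>i. \<exists>p. p \<in> N \<and> s i - p \<in> perp H N"
    proof
      fix i
      obtain p n where "s i = p + n" "p \<in> N" "n \<in> perp H N"
        using s[of i] by blast
      then show "\<exists>p. p \<in> N \<and> s i - p \<in> perp H N"
        by (intro exI[of _ p]) simp
    qed
    then obtain p where p: "\<And>i. p i \<in> N" "\<And>i. s i - p i \<in> perp H N"
      by metis
    have pc: "p i \<in> car H" for i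
      using p sub by auto
    have le: "hnorm H (p i - p j) \<le> hnorm H (s i - s j)" for i j
    proof -
      have d: "p i - p j \<in> N"
        using p N closed_submodule_uminus[OF N] unfolding closed_submodule_def
        by (metis diff_conv_add_uminus)
      have "(s i - p i) - (s j - p j) \<in> perp H N"
        using p perp closed_submodule_uminus[OF perp] unfolding closed_submodule_def
        by (metis diff_conv_add_uminus)
      then have "hnorm H (p i - p j) \<le> hnorm H ((p i - p j) + ((s i - p i) - (s j - p j)))"
        using d sub by (intro hnorm_le_orthogonal_sum) (auto simp: perp_def)
      then show ?thesis
        by simp
    qed
    obtain q where q: "hlim H p q"
      using hlim_complete[of p] pc hlim_Cauchy[OF lim] le by (meson order_le_less_trans)
    have "q \<in> N"
      using closed_submodule_hlim[OF N p(1) q] .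
    moreover have "x - q \<in> perp H N"
      using closed_submodule_hlim[OF perp p(2) hlim_diff[OF lim q]] .
    moreover have "x = q + (x - q)"
      by simp
    ultimately show ?thesis
      by blast
  qed
qed

lemma complementedI:
  assumes N: "closed_submodule H N"
    and split: "\<And>z. z \<in> car H \<Longrightarrow> \<exists>p\<in>N. \<exists>n\<in>perp H N. z = p + n"
  shows "complemented H N"
  unfolding complemented_def hm_iso_def ip_preserving_def
proof (intro conjI N ballI)
  let ?D = "direct_sum (H\<lparr>car := N\<rparr>) (H\<lparr>car := perp H N\<rparr>)"
  have sub: "N \<subseteq> car H"
    using N by (simp add: closed_submodule_def)
  have D: "car ?D = N \<times> perp H N"
    by (simp add: direct_sum_def)
  show in_car: "(case z of (p, n) \<Rightarrow> p + n) \<in> car H" if "z \<in> car ?D" for z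
    using that sub unfolding D by (auto simp: perp_def intro: add_closed)
  show "ip H (case z of (p, n) \<Rightarrow> p + n) (case z' of (p, n) \<Rightarrow> p + n) = ip ?D z z'"
    if z: "z \<in> car ?D" "z' \<in> car ?D" for z z'
  proof -
    obtain p n p' n' where *: "z = (p, n)" "z' = (p', n')" "p \<in> N" "n \<in> perp H N" "p' \<in> N" "n' \<in> perp H N"
      using z unfolding D by blast
    then have c: "p \<in> car H" "n \<in> car H" "p' \<in> car H" "n' \<in> car H"
      using sub by (auto simp: perp_def)
    have "ip H p n' = 0" "ip H p' n = 0"
      using * by (auto simp: perp_def)
    then have "ip H p n' = 0" "ip H n p' = 0"
      using ip_star[OF c(3,2)] by simp_all
    then show ?thesis
      using c by (simp add: * direct_sum_def ip_add_left ip_add_right add_closed)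
  qed
  show "(\<lambda>(p, n). p + n) ` car ?D = car H"
  proof
    show "(\<lambda>(p, n). p + n) ` car ?D \<subseteq> car H"
      using in_car by blast
    show "car H \<subseteq> (\<lambda>(p, n). p + n) ` car ?D"
      using split unfolding D by fastforce
  qed
qed

lemma complemented_decompose:
  assumes "complemented H N" "z \<in> car H"
  obtains p n where "p \<in> N" "n \<in> perp H N" "z = p + n"
proof -
  have "z \<in> (\<lambda>(p, n). p + n) ` (N \<times> perp H N)"
    using assms by (simp add: complemented_def hm_iso_def direct_sum_def)
  then show thesis
    using that by auto
qed

lemma complemented_cyclic:
  assumes "closed_submodule H (range (ract H v))" "v \<in> car H" "ip H v v = 1"
  shows "complemented H (range (ract H v))"
proof (rule complementedI[OF assms(1)])
  fix z assume z: "z \<in> car H"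
  define p where "p = ract H v (ip H v z)"
  have p: "p \<in> car H"
    using assms by (simp add: p_def ract_closed)
  have "ip H (ract H v a) (z - p) = 0" for a
    using assms z p
    by (simp add: ip_minus_right ract_closed ip_ract_left) (simp add: p_def ip_ract_right ract_closed assms)
  then have "z - p \<in> perp H (range (ract H v))"
    using z p by (auto simp: perp_def minus_closed)
  moreover have "p \<in> range (ract H v)"
    by (auto simp: p_def)
  moreover have "z = p + (z - p)"
    by simp
  ultimately show "\<exists>p\<in>range (ract H v). \<exists>n\<in>perp H (range (ract H v)). z = p + n"
    by blast
qed

end

section \<open>Inner-product preserving maps\<close>

lemma ip_preservingD:
  assumes "ip_preserving H K S"
  shows "x \<in> car H \<Longrightarrow> S x \<in> car K"
    and "x \<in> car H \<Longrightarrow> y \<in> car H \<Longrightarrow> ip K (S x) (S y) = ip H x y"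
  using assms by (auto simp: ip_preserving_def)

lemma ip_preserving_comp:
  "ip_preserving H K S \<Longrightarrow> ip_preserving K J T \<Longrightarrow> ip_preserving H J (T \<circ> S)"
  by (auto simp: ip_preserving_def)

lemma hm_iso_comp: "hm_iso H K S \<Longrightarrow> hm_iso K J T \<Longrightarrow> hm_iso H J (T \<circ> S)"
  unfolding hm_iso_def by (metis ip_preserving_comp image_comp)

context
  fixes H :: "('a::unital_cstar_algebra, 'h::ab_group_add, 'z) hmod_scheme"
    and K :: "('a, 'k::ab_group_add, 'w) hmod_scheme"
    and S :: "'h \<Rightarrow> 'k"
  assumes H: "hilbert_module H" and K: "hilbert_module K" and S: "ip_preserving H K S"
begin

interpretation H: hilbert_module H by (rule H)
interpretation K: hilbert_module K by (rule K)

lemma ip_preserving_zero: "S 0 = 0"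
  using ip_preserving_add[OF H K S, of 0 0] by (simp add: H.zero_closed)

lemma ip_preserving_minus:
  assumes "x \<in> car H" "y \<in> car H"
  shows "S (x - y) = S x - S y"
  using ip_preserving_add[OF H K S, of "x - y" y] assms by (simp add: H.minus_closed)

lemma hnorm_ip_preserving: "x \<in> car H \<Longrightarrow> hnorm K (S x) = hnorm H x"
  using S by (simp add: hnorm_def ip_preserving_def)

lemma ip_preserving_inj_on: "inj_on S (car H)"
proof (rule inj_onI)
  fix x y assume xy: "x \<in> car H" "y \<in> car H" "S x = S y"
  then have "hnorm H (x - y) = 0"
    using hnorm_ip_preserving[of "x - y"] by (simp add: H.minus_closed ip_preserving_minus)
  then show "x = y"
    using xy H.hnorm_eq_zero[of "x - y"] by (simp add: H.minus_closed)
qed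

lemma ip_preserving_hlim:
  assumes "hlim H s x"
  shows "hlim K (\<lambda>i. S (s i)) (S x)"
proof -
  have "hnorm K (S (s i) - S x) = hnorm H (s i - x)" for i
    using assms H.hlimD hnorm_ip_preserving[of "s i - x"]
    by (simp add: H.minus_closed ip_preserving_minus)
  then show ?thesis
    using assms S by (simp add: hlim_def ip_preserving_def)
qed

text \<open>The preimages of a convergent sequence are Cauchy because \<open>S\<close> is isometric,
  and the domain is complete.\<close>

lemma closed_submodule_image: "closed_submodule K (S ` car H)"
proof (rule K.closed_submoduleI)
  show "y \<in> S ` car H" if s: "\<And>i. s i \<in> S ` car H" and lim: "hlim K s y" for s y
  proof -
    have "\<forall>i. \<exists>x\<in>car H. s i = S x"
      using s by blast
    then obtain t where t: "\<And>i. t i \<in> car H" "\<And>i. s i = S (t i)"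
      by metis
    have "hnorm K (s i - s j) = hnorm H (t i - t j)" for i j
      using t hnorm_ip_preserving[of "t i - t j"] by (simp add: H.minus_closed ip_preserving_minus)
    then obtain x where x: "hlim H t x"
      using H.hlim_complete[of t] t(1) K.hlim_Cauchy[OF lim] by metis
    then have "hlim K s (S x)"
      using ip_preserving_hlim[OF x] t(2) by (simp add: hlim_def)
    then show ?thesis
      using K.hlim_unique[OF lim] H.hlimD(2)[OF x] by blast
  qed
next
  show "0 \<in> S ` car H"
    using ip_preserving_zero H.zero_closed by force
  show "x + y \<in> S ` car H" if "x \<in> S ` car H" "y \<in> S ` car H" for x y
    using that ip_preserving_add[OF H K S] H.add_closed by (metis (no_types, lifting) imageE imageI)
  show "ract K x a \<in> S ` car H" if "x \<in> S ` car H" for x a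
    using that ip_preserving_ract[OF H K S] H.ract_closed by (metis (no_types, lifting) imageE imageI)
qed (use S in \<open>auto simp: ip_preserving_def\<close>)

end

lemma complemented_image:
  assumes H: "hilbert_module H" and K: "hilbert_module K" and U: "hm_iso H K U"
    and N: "complemented H N"
  shows "complemented K (U ` N)"
proof (rule hilbert_module.complementedI[OF K])
  interpret H: hilbert_module H by (rule H)
  have ipU: "ip_preserving H K U" and surj: "U ` car H = car K"
    using U by (auto simp: hm_iso_def)
  have closed: "closed_submodule H N"
    using N by (simp add: complemented_def)
  then have sub: "N \<subseteq> car H"
    by (simp add: closed_submodule_def)
  then have "ip_preserving (H\<lparr>car := N\<rparr>) K U"
    using ipU by (auto simp: ip_preserving_def)
  from closed_submodule_image[OF H.hilbert_module_restrict[OF closed] K this]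
  show "closed_submodule K (U ` N)"
    by simp
  fix z assume "z \<in> car K"
  then obtain x where x: "x \<in> car H" "z = U x"
    using surj by blast
  obtain p n where pn: "p \<in> N" "n \<in> perp H N" "x = p + n"
    using H.complemented_decompose[OF N x(1)] .
  have "U n \<in> perp K (U ` N)"
    using pn(2) sub ipU by (auto simp: perp_def ip_preserving_def subset_iff)
  moreover have "z = U p + U n"
    using pn sub x(2) by (auto simp: perp_def ip_preserving_add[OF H K ipU])
  ultimately show "\<exists>p\<in>U ` N. \<exists>n\<in>perp K (U ` N). z = p + n"
    using pn(1) by blast
qed

lemma dense_in_image:
  assumes H: "hilbert_module H" and K: "hilbert_module K" and U: "hm_iso H K U"
    and D: "dense_in H D"
  shows "dense_in K (U ` D)"
proof -
  interpret H: hilbert_module H by (rule H)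
  interpret K: hilbert_module K by (rule K)
  have ipU: "ip_preserving H K U" and surj: "U ` car H = car K"
    using U by (auto simp: hm_iso_def)
  have D': "D \<subseteq> car H" "hclosure H D = car H"
    using D by (auto simp: dense_in_def)
  then have sub: "U ` D \<subseteq> car K"
    using surj by blast
  have "U x \<in> hclosure K (U ` D)" if "x \<in> car H" for x
  proof -
    have "x \<in> hclosure H D"
      using that D'(2) by simp
    then obtain f where "\<And>i. f i \<in> D" "hlim H f x"
      unfolding H.hclosure_iff_hlim[OF D'(1)] by auto
    then have "(\<forall>i. U (f i) \<in> U ` D) \<and> hlim K (\<lambda>i. U (f i)) (U x)"
      using ip_preserving_hlim[OF H K ipU] by blast
    then show ?thesis
      unfolding K.hclosure_iff_hlim[OF sub] by (rule exI[of _ "\<lambda>i. U (f i)"])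
  qed
  then have "car K \<subseteq> hclosure K (U ` D)"
    unfolding surj[symmetric] by (rule image_subsetI)
  then show ?thesis
    using sub unfolding dense_in_def by (auto simp: hclosure_def)
qed

section \<open>Extension and uniqueness of inner-product preserving maps\<close>

text \<open>Prescribing the map by a relation \<open>C\<close> leaves no well-definedness to verify:
  elements related to the same vector have equal inner products with each other and with themselves,
  hence are equal. For the same reason \<open>C\<close> need not be linear.\<close>

lemma isometric_relation_extension:
  fixes H :: "('a::unital_cstar_algebra, 'h::ab_group_add, 'z) hmod_scheme"
    and K :: "('a, 'k::ab_group_add, 'w) hmod_scheme"
  assumes H: "hilbert_module H" and K: "hilbert_module K"
    and C: "C \<subseteq> car H \<times> car K"
    and iso: "\<And>p q. p \<in> C \<Longrightarrow> q \<in> C \<Longrightarrow> ip H (fst p) (fst q) = ip K (snd p) (snd q)"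
    and dense: "dense_in H (fst ` C)"
  obtains F where "ip_preserving H K F" "\<And>p. p \<in> C \<Longrightarrow> F (fst p) = snd p"
proof -
  interpret H: hilbert_module H by (rule H)
  interpret K: hilbert_module K by (rule K)
  define R where "R x y \<longleftrightarrow> (\<exists>p. (\<forall>i. p i \<in> C) \<and> hlim H (\<lambda>i. fst (p i)) x \<and> hlim K (\<lambda>i. snd (p i)) y)"
    for x y
  have mem: "fst p \<in> car H" "snd p \<in> car K" if "p \<in> C" for p
    using C that by auto
  \<comment> \<open>Distances are determined by inner products, so first components that form a
    Cauchy sequence force the second components to do so.\<close>
  have hn: "hnorm H (fst p - fst q) = hnorm K (snd p - snd q)" if "p \<in> C" "q \<in> C" for p q
    using that mem iso by (simp add: hnorm_def H.ip_minus_left H.ip_minus_right K.ip_minus_left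
        K.ip_minus_right H.minus_closed K.minus_closed)
  have ex: "\<exists>y. R x y" if "x \<in> car H" for x
  proof -
    have "x \<in> hclosure H (fst ` C)" "fst ` C \<subseteq> car H"
      using dense that by (auto simp: dense_in_def)
    then obtain s where s: "\<And>i. s i \<in> fst ` C" "hlim H s x"
      using H.hclosure_iff_hlim by blast
    then have "\<forall>i. \<exists>p\<in>C. s i = fst p"
      by blast
    then obtain p where p: "\<And>i. p i \<in> C" "\<And>i. s i = fst (p i)"
      by metis
    have "\<exists>N. \<forall>i\<ge>N. \<forall>j\<ge>N. hnorm K (snd (p i) - snd (p j)) < e" if "e > 0" for e
      using H.hlim_Cauchy[OF s(2) that] p hn by simp
    then obtain y where "hlim K (\<lambda>i. snd (p i)) y"
      using K.hlim_complete[of "\<lambda>i. snd (p i)"] p(1) mem by metis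
    moreover have "s = (\<lambda>i. fst (p i))"
      using p(2) by blast
    ultimately show ?thesis
      using p(1) s(2) unfolding R_def by blast
  qed
  have R_ip: "ip K y y' = ip H x x'" if R: "R x y" "R x' y'" for x y x' y'
  proof -
    obtain p q where p: "\<And>i. p i \<in> C" "hlim H (\<lambda>i. fst (p i)) x" "hlim K (\<lambda>i. snd (p i)) y"
      and q: "\<And>i. q i \<in> C" "hlim H (\<lambda>i. fst (q i)) x'" "hlim K (\<lambda>i. snd (q i)) y'"
      using R unfolding R_def by metis
    have "(\<lambda>i. ip K (snd (p i)) (snd (q i))) \<longlonglongrightarrow> ip H x x'"
      using H.hlim_ip[OF p(2) q(2)] iso[OF p(1) q(1)] by simp
    then show ?thesis
      using K.hlim_ip[OF p(3) q(3)] LIMSEQ_unique by blast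
  qed
  have R_car: "y \<in> car K" if "R x y" for x y
    using that by (auto simp: R_def hlim_def)
  have R_unique: "y = y'" if "R x y" "R x y'" for x y y'
    by (rule K.eq_if_ip_eq[where c = "ip H x x"]) (use that R_ip R_car in auto)
  define F where "F x = (SOME y. R x y)" for x
  have RF: "R x (F x)" if "x \<in> car H" for x
    unfolding F_def using ex[OF that] by (rule someI_ex)
  show thesis
  proof
    show "ip_preserving H K F"
      unfolding ip_preserving_def using R_car[OF RF] R_ip[OF RF RF] by blast
    show "F (fst p) = snd p" if "p \<in> C" for p
    proof -
      have "R (fst p) (snd p)"
        unfolding R_def using that mem[OF that] H.hlim_const K.hlim_const
        by (intro exI[of _ "\<lambda>_. p"]) simp
      then show ?thesis
        using RF mem(1)[OF that] R_unique by blast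
    qed
  qed
qed

text \<open>Pair each finite combination of the \<open>u i\<close> with the same combination of the
  \<open>v i\<close>. One vector may have many such representations, which is harmless for a
  relation.\<close>

lemma isometric_family_extension:
  fixes H :: "('a::unital_cstar_algebra, 'h::ab_group_add, 'z) hmod_scheme"
    and K :: "('a, 'k::ab_group_add, 'w) hmod_scheme"
    and u :: "'i \<Rightarrow> 'h" and v :: "'i \<Rightarrow> 'k"
  assumes H: "hilbert_module H" and K: "hilbert_module K"
    and u: "\<And>i. i \<in> I \<Longrightarrow> u i \<in> car H" and v: "\<And>i. i \<in> I \<Longrightarrow> v i \<in> car K"
    and iso: "\<And>i j. i \<in> I \<Longrightarrow> j \<in> I \<Longrightarrow> ip K (v i) (v j) = ip H (u i) (u j)"
    and dense: "dense_in H (hspan H (u ` I))"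
  obtains F where "ip_preserving H K F" "\<And>i. i \<in> I \<Longrightarrow> F (u i) = v i"
proof -
  interpret H: hilbert_module H by (rule H)
  interpret K: hilbert_module K by (rule K)
  define C where "C = {(\<Sum>i<n. ract H (u (t i)) (a i), \<Sum>i<n. ract K (v (t i)) (a i)) | (n::nat) t a.
    \<forall>i<n. t i \<in> I}"
  have sub: "C \<subseteq> car H \<times> car K"
    unfolding C_def using u v by (auto intro!: H.sum_closed H.ract_closed K.sum_closed K.ract_closed)
  have ipC: "ip H (fst p) (fst q) = ip K (snd p) (snd q)" if "p \<in> C" "q \<in> C" for p q
  proof -
    obtain n t a where p: "p = (\<Sum>i<n::nat. ract H (u (t i)) (a i), \<Sum>i<n. ract K (v (t i)) (a i))"
        "\<forall>i<n. t i \<in> I"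
      using \<open>p \<in> C\<close> unfolding C_def by blast
    obtain n' t' a' where q: "q = (\<Sum>i<n'::nat. ract H (u (t' i)) (a' i), \<Sum>i<n'. ract K (v (t' i)) (a' i))"
        "\<forall>i<n'. t' i \<in> I"
      using \<open>q \<in> C\<close> unfolding C_def by blast
    have c: "u (t i) \<in> car H" "v (t i) \<in> car K" if "i \<in> {..<n}" for i
      using that p(2) u v by auto
    have c': "u (t' i) \<in> car H" "v (t' i) \<in> car K" if "i \<in> {..<n'}" for i
      using that q(2) u v by auto
    have "ip H (fst p) (fst q)
        = (\<Sum>i<n. \<Sum>j<n'. star (a i) * (ip H (u (t i)) (u (t' j)) * a' j))"
      unfolding p(1) q(1) fst_conv
      by (simp only: H.ip_sum_left[OF H.sum_closed] H.ip_sum_right H.ract_closed c c'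
          H.ip_ract_left H.ip_ract_right mult.assoc cong: sum.cong)
    also have "\<dots> = (\<Sum>i<n. \<Sum>j<n'. star (a i) * (ip K (v (t i)) (v (t' j)) * a' j))"
      using p(2) q(2) by (simp add: iso)
    also have "\<dots> = ip K (snd p) (snd q)"
      unfolding p(1) q(1) snd_conv
      by (simp only: K.ip_sum_left[OF K.sum_closed] K.ip_sum_right K.ract_closed c c'
          K.ip_ract_left K.ip_ract_right mult.assoc cong: sum.cong)
    finally show ?thesis .
  qed
  have "hspan H (u ` I) \<subseteq> fst ` C"
  proof
    fix x assume "x \<in> hspan H (u ` I)"
    then obtain n s a where x: "x = (\<Sum>i<n::nat. ract H (s i) (a i))" "\<forall>i<n. s i \<in> u ` I"
      unfolding hspan_def by blast
    then have "\<forall>i. \<exists>j. i < n \<longrightarrow> j \<in> I \<and> s i = u j"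
      by blast
    then obtain t where t: "\<And>i. i < n \<Longrightarrow> t i \<in> I \<and> s i = u (t i)"
      by metis
    then have "(x, \<Sum>i<n. ract K (v (t i)) (a i)) \<in> C"
      unfolding C_def x(1) by auto
    then show "x \<in> fst ` C"
      by force
  qed
  then have "dense_in H (fst ` C)"
    using dense sub unfolding dense_in_def hclosure_def by fastforce
  then obtain F where F: "ip_preserving H K F" "\<And>p. p \<in> C \<Longrightarrow> F (fst p) = snd p"
    using isometric_relation_extension[OF H K sub ipC] by metis
  have "F (u i) = v i" if "i \<in> I" for i
  proof -
    have "(\<Sum>j<1::nat. ract H (u i) 1, \<Sum>j<1::nat. ract K (v i) 1) \<in> C"
      unfolding C_def using that by fast
    then show ?thesis
      using F(2) that u v by (fastforce simp: H.ract_one K.ract_one)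
  qed
  then show thesis
    using that F(1) by blast
qed

text \<open>Generation is phrased as an induction principle over closed submodules. In this form it
  passes to tensor products without approximating twice.\<close>

definition generates ::
  "('a::unital_cstar_algebra, 'h::ab_group_add, 'z) hmod_scheme \<Rightarrow> 'h set \<Rightarrow> bool" where
  "generates H S \<longleftrightarrow> S \<subseteq> car H \<and> (\<forall>N. closed_submodule H N \<longrightarrow> S \<subseteq> N \<longrightarrow> N = car H)"

lemma generatesD: "generates H S \<Longrightarrow> closed_submodule H N \<Longrightarrow> S \<subseteq> N \<Longrightarrow> N = car H"
  by (simp add: generates_def)

lemma dense_in_generates:
  assumes "dense_in H S"
  shows "generates H S"
  unfolding generates_def
proof (intro conjI allI impI)
  show "S \<subseteq> car H"
    using assms by (simp add: dense_in_def)
  show "N = car H" if N: "closed_submodule H N" "S \<subseteq> N" for N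
  proof -
    have "car H \<subseteq> hclosure H N"
      using assms N(2) by (fastforce simp: dense_in_def hclosure_def)
    then show ?thesis
      using N(1) by (auto simp: closed_submodule_def)
  qed
qed

text \<open>The set on which the two maps agree is a closed submodule.\<close>

lemma ip_preserving_eqI:
  assumes H: "hilbert_module H" and K: "hilbert_module K"
    and F: "ip_preserving H K F" and G: "ip_preserving H K G"
    and gen: "generates H S" and eq: "\<And>x. x \<in> S \<Longrightarrow> F x = G x"
    and x: "x \<in> car H"
  shows "F x = G x"
proof -
  interpret H: hilbert_module H by (rule H)
  interpret K: hilbert_module K by (rule K)
  have "closed_submodule H {x \<in> car H. F x = G x}"
  proof (rule H.closed_submoduleI)
    show "x \<in> {x \<in> car H. F x = G x}" if "\<And>i. s i \<in> {x \<in> car H. F x = G x}" "hlim H s x" for s x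
    proof -
      have "hlim K (\<lambda>i. F (s i)) (F x)" "hlim K (\<lambda>i. F (s i)) (G x)"
        using ip_preserving_hlim[OF H K F that(2)] ip_preserving_hlim[OF H K G that(2)] that(1) by simp_all
      then show ?thesis
        using K.hlim_unique H.hlimD(2)[OF that(2)] by blast
    qed
  qed (auto simp: H.zero_closed H.add_closed H.ract_closed ip_preserving_zero[OF H K F]
      ip_preserving_zero[OF H K G] ip_preserving_add[OF H K F] ip_preserving_add[OF H K G]
      ip_preserving_ract[OF H K F] ip_preserving_ract[OF H K G])
  from generatesD[OF gen this] have "{x \<in> car H. F x = G x} = car H"
    using eq gen by (auto simp: generates_def)
  then show ?thesis
    using x by blast
qed

text \<open>An isometric image of a complete module is closed, so surjectivity needs to be checked
  on generators only.\<close>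

lemma hm_isoI:
  assumes H: "hilbert_module H" and K: "hilbert_module K" and F: "ip_preserving H K F"
    and gen: "generates K S" and sub: "S \<subseteq> F ` car H"
  shows "hm_iso H K F"
  using generatesD[OF gen closed_submodule_image[OF H K F] sub] F by (simp add: hm_iso_def)

section \<open>Internal tensor products\<close>

lemma (in correspondence) lact_zero: "n \<in> car M \<Longrightarrow> lact M 0 n = 0"
  using lact_add[of n 0 0] by simp

text \<open>For \<open>norm b < 1\<close> write \<open>1 - star b * b = h * h\<close>. Then
  \<open>ip M n n - ip M (lact M b n) (lact M b n)\<close> is a sum of two elements of the form
  \<open>ip M x x\<close>, and the norm is monotone on positive elements.\<close>

lemma (in correspondence) hnorm_lact_le:
  assumes "n \<in> car M"
  shows "hnorm M (lact M a n) \<le> norm a * hnorm M n"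
proof -
  have lt: "hnorm M (lact M b n) \<le> hnorm M n" if "norm b < 1" for b
  proof -
    define c where "c = star b * b"
    have "norm c = norm b * norm b"
      by (simp add: c_def cstar_identity power2_eq_square)
    also have "\<dots> < 1"
      using mult_strict_mono'[OF that that] by simp
    finally obtain h where h: "star h = h" "h * h = 1 - c"
      using sqrt_one_minus[of c] by (metis c_def star_mult star_star)
    \<comment> \<open>The left action is not assumed to be essential here: \<open>1\<close> acts as
      a projection, and \<open>n - n'\<close> contributes its own inner product.\<close>
    define n' where "n' = lact M 1 n"
    have c: "n' \<in> car M" "lact M b n \<in> car M" "lact M h n \<in> car M" "lact M c n \<in> car M"
      using assms by (simp_all add: n'_def lact_closed)
    have "lact M 1 n = lact M (h * h) n + lact M c n"
      using lact_add[of n "h * h" c] assms by (simp add: h(2))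
    moreover have "lact M (h * h) n = lact M h (lact M h n)"
      using assms by (simp add: lact_mult)
    ultimately have "ip M n n' = ip M (lact M h n) (lact M h n) + ip M (lact M b n) (lact M b n)"
      using assms c by (simp add: n'_def ip_add_right lact_closed lact_adjoint h(1) c_def lact_mult)
    moreover have n'n': "ip M n' n' = ip M n n'"
      using assms by (simp add: n'_def lact_adjoint lact_closed flip: lact_mult)
    moreover have "ip M n' n = ip M n n'"
      using assms by (simp add: n'_def lact_adjoint)
    ultimately have "ip M n n - ip M (lact M b n) (lact M b n)
        = ip M (n - n') (n - n') + ip M (lact M h n) (lact M h n)"
      using assms c by (simp add: ip_minus_left ip_minus_right minus_closed)
    then have "norm (ip M (lact M b n) (lact M b n)) \<le> norm (ip M n n)"
      using assms c by (intro norm_mono_norm_positive)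
        (simp_all add: norm_positive_ip norm_positive_add minus_closed)
    then show ?thesis
      by (simp add: hnorm_def)
  qed
  have "hnorm M (lact M a n) \<le> r * hnorm M n" if r: "r > norm a" for r
  proof -
    have "r > 0"
      using r norm_ge_zero[of a] by linarith
    define b where "b = (1 / r) *\<^sub>R a"
    have "norm b < 1"
      using r \<open>r > 0\<close> by (simp add: b_def)
    have "lact M a n = ract M (lact M b n) (r *\<^sub>R 1)"
      using lact_scaleC[OF assms, of "complex_of_real r" b] \<open>r > 0\<close>
      by (simp add: scaleC_of_real b_def)
    then have "hnorm M (lact M a n) \<le> hnorm M (lact M b n) * norm (r *\<^sub>R (1 :: 'a))"
      using hnorm_ract lact_closed[OF assms] by metis
    also have "\<dots> \<le> hnorm M n * r"
      using lt[OF \<open>norm b < 1\<close>] norm_scaleR_one_le[of r, where 'a = 'a] \<open>r > 0\<close>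
      by (intro mult_mono) auto
    finally show ?thesis
      by (simp add: mult.commute)
  qed
  note le = this
  show ?thesis
  proof (cases "hnorm M n = 0")
    case True
    then show ?thesis
      using le[of "norm a + 1"] by simp
  next
    case False
    then have pos: "hnorm M n > 0"
      using hnorm_ge_zero[of n] by linarith
    \<comment> \<open>The square root requires norm strictly less than 1, so the estimate is known
      for every \<open>r > norm a\<close> and is carried to the boundary.\<close>
    have "hnorm M (lact M a n) / hnorm M n \<le> norm a"
      by (rule dense_ge) (use le pos in \<open>simp add: pos_divide_le_eq\<close>)
    then show ?thesis
      using pos by (simp add: pos_divide_le_eq)
  qed
qed

section \<open>Elementary tensors and maps of the form \<open>S \<otimes> id\<close>\<close>

locale tensor_product = X: hilbert_module X + E: correspondence E + Z: hilbert_module Z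
  for X :: "('a::unital_cstar_algebra, 'x::ab_group_add, 'z1) hmod_scheme"
    and E :: "('a, 'e::ab_group_add, 'z2) corr_scheme"
    and Z :: "('a, 't::ab_group_add, 'z3) hmod_scheme"
    and s :: "'x \<Rightarrow> 'e \<Rightarrow> 't" +
  assumes tensor: "internal_tensor X E Z s"
begin

lemma tensor_closed: "x \<in> car X \<Longrightarrow> n \<in> car E \<Longrightarrow> s x n \<in> car Z"
  using tensor by (simp add: internal_tensor_def)

lemma ip_tensor:
  "x \<in> car X \<Longrightarrow> x' \<in> car X \<Longrightarrow> n \<in> car E \<Longrightarrow> n' \<in> car E \<Longrightarrow>
   ip Z (s x n) (s x' n') = ip E n (lact E (ip X x x') n')"
  using tensor by (simp add: internal_tensor_def)

lemmas tensor_balanced = internal_tensor_balanced[OF X.hilbert_module_axioms E.correspondence_axioms tensor]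
  and tensor_add_left = internal_tensor_add_left[OF X.hilbert_module_axioms E.correspondence_axioms tensor]

lemma tensor_minus_left:
  "x \<in> car X \<Longrightarrow> x' \<in> car X \<Longrightarrow> n \<in> car E \<Longrightarrow> s (x - x') n = s x n - s x' n"
  using tensor_add_left[of "x - x'" x' n] by (simp add: X.minus_closed)

text \<open>Contractivity of the left action enters here; the bound makes elementary tensors
  continuous in the left factor.\<close>

lemma hnorm_tensor_le:
  assumes "x \<in> car X" "n \<in> car E"
  shows "hnorm Z (s x n) \<le> hnorm X x * hnorm E n"
proof (rule power2_le_imp_le)
  have "(hnorm Z (s x n))\<^sup>2 = norm (ip E n (lact E (ip X x x) n))"
    using assms by (simp add: Z.hnorm_squared ip_tensor)
  also have "\<dots> \<le> hnorm E n * hnorm E (lact E (ip X x x) n)"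
    using assms by (simp add: E.norm_ip_le E.lact_closed)
  also have "\<dots> \<le> hnorm E n * (norm (ip X x x) * hnorm E n)"
    using assms by (intro mult_left_mono E.hnorm_lact_le) auto
  finally show "(hnorm Z (s x n))\<^sup>2 \<le> (hnorm X x * hnorm E n)\<^sup>2"
    by (simp add: X.hnorm_squared[symmetric] power2_eq_square mult_ac)
qed simp

lemma tensor_hlim_left:
  assumes "hlim X f x" "n \<in> car E"
  shows "hlim Z (\<lambda>i. s (f i) n) (s x n)"
proof (rule Z.hlim_comparison)
  show "hnorm Z (s (f i) n - s x n) \<le> hnorm X (f i - x) * hnorm E n" for i
    using hnorm_tensor_le[of "f i - x" n] assms X.hlimD
    by (simp add: tensor_minus_left X.minus_closed)
  show "(\<lambda>i. hnorm X (f i - x) * hnorm E n) \<longlonglongrightarrow> 0"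
    using assms by (auto simp: hlim_def intro: tendsto_mult_left_zero)
qed (use assms X.hlimD tensor_closed in auto)

lemma tensor_zero_left: "n \<in> car E \<Longrightarrow> s 0 n = 0"
  using tensor_add_left[of 0 0 n] by (simp add: X.zero_closed)

lemma generates_elementary: "generates Z {s x n | x n. x \<in> car X \<and> n \<in> car E}"
proof -
  let ?S = "{s x n | x n. x \<in> car X \<and> n \<in> car E}"
  have "generates Z (hspan Z ?S)"
    using tensor by (intro dense_in_generates) (simp add: internal_tensor_def)
  then show ?thesis
    using tensor_closed Z.hspan_subset[of _ ?S] unfolding generates_def by blast
qed

text \<open>Given a closed submodule \<open>N\<close> of \<open>Z\<close>, the \<open>x\<close>
  whose tensors with all of \<open>E\<close> lie in \<open>N\<close> form a closed submodule of
  \<open>X\<close>: balancedness moves the right action over to \<open>E\<close>, and continuity in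
  the left factor handles limits.\<close>

lemma generates_tensor:
  assumes gen: "generates X S"
  shows "generates Z {s x n | x n. x \<in> S \<and> n \<in> car E}"
  unfolding generates_def
proof (intro conjI allI impI)
  show "{s x n | x n. x \<in> S \<and> n \<in> car E} \<subseteq> car Z"
    using gen tensor_closed by (auto simp: generates_def)
  fix N assume N: "closed_submodule Z N" "{s x n | x n. x \<in> S \<and> n \<in> car E} \<subseteq> N"
  let ?Y = "{x \<in> car X. \<forall>n\<in>car E. s x n \<in> N}"
  have "closed_submodule X ?Y"
  proof (rule X.closed_submoduleI)
    show "x \<in> ?Y" if "\<And>i. f i \<in> ?Y" "hlim X f x" for f x
      using that Z.closed_submodule_hlim[OF N(1) _ tensor_hlim_left[OF that(2)]] X.hlimD(2)[OF that(2)]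
      by blast
  qed (use N(1) in \<open>auto simp: X.zero_closed X.add_closed X.ract_closed tensor_zero_left
        tensor_add_left tensor_balanced E.lact_closed closed_submodule_def\<close>)
  then have "?Y = car X"
    using gen N(2) by (intro generatesD[OF gen]) (auto simp: generates_def)
  then have "{s x n | x n. x \<in> car X \<and> n \<in> car E} \<subseteq> N"
    by blast
  then show "N = car Z"
    using generatesD[OF generates_elementary N(1)] by blast
qed

text \<open>With \<open>ip X v v = 1\<close> the tensor inner product becomes that of
  \<open>n\<close> with \<open>lact E 1 n'\<close>; this is where essentiality is needed.\<close>

lemma tensor_left_ip_preserving:
  assumes "essential E" "v \<in> car X" "ip X v v = 1"
  shows "ip_preserving E Z (s v)"
  using assms by (simp add: ip_preserving_def tensor_closed ip_tensor essential_def)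

text \<open>The projection onto \<open>v \<otimes> E\<close> is \<open>v \<langle>v, \<cdot>\<rangle> \<otimes> id\<close>.\<close>

lemma complemented_tensor_left:
  assumes E: "essential E" and v: "v \<in> car X" "ip X v v = 1"
  shows "complemented Z (s v ` car E)"
proof (rule Z.complementedI)
  show N: "closed_submodule Z (s v ` car E)"
    by (rule closed_submodule_image[OF E.hilbert_module_axioms Z.hilbert_module_axioms
          tensor_left_ip_preserving[OF assms]])
  let ?S = "{p + n | p n. p \<in> s v ` car E \<and> n \<in> perp Z (s v ` car E)}"
  have "s x n \<in> ?S" if x: "x \<in> car X" and n: "n \<in> car E" for x n
  proof -
    \<comment> \<open>Splitting \<open>x\<close> along \<open>v\<close> splits the elementary
      tensor: balancedness turns \<open>s x' n\<close> into
      \<open>s v (lact E (ip X v x) n)\<close>, and \<open>x - x'\<close> is orthogonal to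
      \<open>v\<close>.\<close>
    define x' where "x' = ract X v (ip X v x)"
    have c: "x' \<in> car X" "x - x' \<in> car X"
      using v x by (simp_all add: x'_def X.ract_closed X.minus_closed)
    have "ip X v (x - x') = 0"
      using v x c(1) by (simp add: X.ip_minus_right) (simp add: x'_def X.ip_ract_right v)
    then have "s (x - x') n \<in> perp Z (s v ` car E)"
      using c(2) v n
      by (auto simp: perp_def tensor_closed ip_tensor E.lact_zero E.ip_zero_right)
    moreover have "s x' n \<in> s v ` car E"
      using v n unfolding x'_def by (simp add: tensor_balanced E.lact_closed)
    moreover have "s x n = s x' n + s (x - x') n"
      using c x n by (simp add: tensor_minus_left)
    ultimately show ?thesis
      by blast
  qed
  then have "?S = car Z"
    using generatesD[OF generates_elementary Z.closed_submodule_orthogonal_sum[OF N]] by blast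
  then show "\<exists>p\<in>s v ` car E. \<exists>n\<in>perp Z (s v ` car E). z = p + n" if "z \<in> car Z" for z
    using that by blast
qed

text \<open>Justifies the choice in \<open>tensor_id\<close>: on elementary tensors the prescribed
  values have the right inner products, so the isometric extension exists.\<close>

lemma tensor_id_props:
  fixes X' :: "('a, 'x'::ab_group_add, 'z4) hmod_scheme" and Z' :: "('a, 't'::ab_group_add, 'z5) hmod_scheme"
  assumes T': "internal_tensor X' E Z' s'" and S: "ip_preserving X X' S"
  shows ip_preserving_tensor_id: "ip_preserving Z Z' (tensor_id X E Z s S Z' s')"
    and tensor_id_tensor:
      "\<And>x n. x \<in> car X \<Longrightarrow> n \<in> car E \<Longrightarrow> tensor_id X E Z s S Z' s' (s x n) = s' (S x) n"
proof -
  have Z': "hilbert_module Z'"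
    using T' by (simp add: internal_tensor_def)
  let ?I = "car X \<times> car E"
  have img: "(\<lambda>(x, n). s x n) ` ?I = {s x n | x n. x \<in> car X \<and> n \<in> car E}"
    by auto
  obtain F where F: "ip_preserving Z Z' F" "\<And>i. i \<in> ?I \<Longrightarrow> F (case i of (x, n) \<Rightarrow> s x n) = (case i of (x, n) \<Rightarrow> s' (S x) n)"
  proof (rule isometric_family_extension[OF Z.hilbert_module_axioms Z',
        of ?I "\<lambda>(x, n). s x n" "\<lambda>(x, n). s' (S x) n"])
    show "dense_in Z (hspan Z ((\<lambda>(x, n). s x n) ` ?I))"
      using tensor unfolding img by (simp add: internal_tensor_def)
    show "(case i of (x, n) \<Rightarrow> s' (S x) n) \<in> car Z'" if "i \<in> ?I" for i
      using that T' S by (auto simp: internal_tensor_def ip_preserving_def)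
    show "ip Z' (case i of (x, n) \<Rightarrow> s' (S x) n) (case j of (x, n) \<Rightarrow> s' (S x) n)
        = ip Z (case i of (x, n) \<Rightarrow> s x n) (case j of (x, n) \<Rightarrow> s x n)" if "i \<in> ?I" "j \<in> ?I" for i j
      using that T' S by (auto simp: internal_tensor_def ip_preserving_def ip_tensor)
  qed (auto simp: tensor_closed)
  then have "\<exists>F. ip_preserving Z Z' F \<and> (\<forall>x\<in>car X. \<forall>n\<in>car E. F (s x n) = s' (S x) n)"
    by fastforce
  from someI_ex[OF this] show "ip_preserving Z Z' (tensor_id X E Z s S Z' s')"
    "\<And>x n. x \<in> car X \<Longrightarrow> n \<in> car E \<Longrightarrow> tensor_id X E Z s S Z' s' (s x n) = s' (S x) n"
    unfolding tensor_id_def by auto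
qed

end

lemma tensor_productI:
  assumes "hilbert_module X" "correspondence E" "internal_tensor X E Z s"
  shows "tensor_product X E Z s"
  using assms unfolding internal_tensor_def tensor_product_def tensor_product_axioms_def by blast

text \<open>This lemma and the next transport tensor products along the identifications
  \<open>emb\<close> of \<open>X\<close> with the amplification 0 and \<open>vec\<close> of
  \<open>M\<close> with the power 1.\<close>

lemma internal_tensor_cong_left:
  assumes "internal_tensor X E Z s" "hm_iso X' X u"
  shows "internal_tensor X' E Z (\<lambda>x. s (u x))"
proof -
  have "car X = u ` car X'"
    using assms(2) by (simp add: hm_iso_def)
  then have "{s (u x) n | x n. x \<in> car X' \<and> n \<in> car E} = {s x n | x n. x \<in> car X \<and> n \<in> car E}"
    by auto
  then show ?thesis
    using assms by (auto simp: internal_tensor_def hm_iso_def ip_preserving_def)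
qed

lemma internal_tensor_cong_right:
  assumes "internal_tensor X E Z s" "hm_iso E' E u"
    and "\<And>a n. n \<in> car E' \<Longrightarrow> u (lact E' a n) = lact E a (u n)"
    and "\<And>a n. n \<in> car E' \<Longrightarrow> lact E' a n \<in> car E'"
  shows "internal_tensor X E' Z (\<lambda>x n. s x (u n))"
proof -
  have "car E = u ` car E'"
    using assms(2) by (simp add: hm_iso_def)
  then have "{s x (u n) | x n. x \<in> car X \<and> n \<in> car E'} = {s x n | x n. x \<in> car X \<and> n \<in> car E}"
    by auto
  moreover have u: "u n \<in> car E" if "n \<in> car E'" for n
    using that assms(2) by (auto simp: hm_iso_def ip_preserving_def)
  moreover have "ip E (u n) (lact E a (u n')) = ip E' n (lact E' a n')"
    if "n \<in> car E'" "n' \<in> car E'" for a n n'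
    unfolding assms(3)[OF that(2), symmetric] using assms(2,4) that
    by (simp add: hm_iso_def ip_preserving_def)
  ultimately show ?thesis
    using assms(1) by (auto simp: internal_tensor_def)
qed

lemma hm_iso_cong: "hm_iso H K S \<Longrightarrow> (\<And>x. x \<in> car H \<Longrightarrow> S' x = S x) \<Longrightarrow> hm_iso H K S'"
  unfolding hm_iso_def ip_preserving_def by (simp cong: image_cong)

lemma hm_iso_inv_into:
  assumes "hilbert_module H" "hilbert_module K" "hm_iso H K U"
  shows "hm_iso K H (inv_into (car H) U)"
proof -
  have U: "ip_preserving H K U" "U ` car H = car K" and inj: "inj_on U (car H)"
    using assms ip_preserving_inj_on[of H K U] by (auto simp: hm_iso_def)
  have V: "inv_into (car H) U y \<in> car H" "U (inv_into (car H) U y) = y" if "y \<in> car K" for y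
    using that U(2) by (auto simp: inv_into_into f_inv_into_f)
  have "ip H (inv_into (car H) U y) (inv_into (car H) U y') = ip K y y'"
    if "y \<in> car K" "y' \<in> car K" for y y'
    using ip_preservingD(2)[OF U(1) V(1)[OF that(1)] V(1)[OF that(2)]] V(2) that by simp
  moreover have "inv_into (car H) U ` car K = car H"
    using inv_into_image_cancel[OF inj, of "car H"] U(2) by simp
  ultimately show ?thesis
    using V(1) by (simp add: hm_iso_def ip_preserving_def)
qed

text \<open>The defect \<open>z = n - lact M 1 n\<close> is orthogonal to every generator, because
  \<open>1\<close> acts as a self-adjoint operator. Hence it is orthogonal to everything, including
  itself.\<close>

lemma (in correspondence) essential_if_generates:
  assumes gen: "generates M S" and eq: "\<And>n. n \<in> S \<Longrightarrow> lact M 1 n = n"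
  shows "essential M"
  unfolding essential_def
proof
  fix n assume n: "n \<in> car M"
  define z where "z = n - lact M 1 n"
  have z: "z \<in> car M"
    using n by (simp add: z_def minus_closed lact_closed)
  have "ip M z y = 0" if "y \<in> S" for y
  proof -
    have y: "y \<in> car M"
      using gen that by (auto simp: generates_def)
    then show ?thesis
      using n eq[OF that] by (simp add: z_def ip_minus_left lact_closed lact_adjoint)
  qed
  then have "perp M {z} = car M"
    using gen z by (intro generatesD[OF gen closed_submodule_perp]) (auto simp: perp_def generates_def)
  then have "ip M z z = 0"
    using z by (auto simp: perp_def)
  then show "lact M 1 n = n"
    using ip_definite[OF z] by (simp add: z_def)
qed

section \<open>Direct limits\<close>

text \<open>Relate \<open>\<iota> k x\<close> to \<open>S k x\<close>. Inner products of elements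
  from levels \<open>k\<close> and \<open>l\<close> are compared after both are moved by
  \<open>T\<close> to level \<open>max k l\<close>.\<close>

lemma direct_limit_universal:
  assumes lim: "direct_limit Xs T L \<iota>" and K: "hilbert_module K"
    and T: "\<And>k x. x \<in> car (Xs k) \<Longrightarrow> T k x \<in> car (Xs (Suc k))"
    and S: "\<And>k. ip_preserving (Xs k) K (S k)"
    and ST: "\<And>k x. x \<in> car (Xs k) \<Longrightarrow> S (Suc k) (T k x) = S k x"
  obtains F where "ip_preserving L K F" "\<And>k x. x \<in> car (Xs k) \<Longrightarrow> F (\<iota> k x) = S k x"
proof -
  have L: "hilbert_module L" and \<iota>: "\<And>k. ip_preserving (Xs k) L (\<iota> k)"
    and \<iota>T: "\<And>k x. x \<in> car (Xs k) \<Longrightarrow> \<iota> (Suc k) (T k x) = \<iota> k x"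
    and dense: "dense_in L (\<Union>k. \<iota> k ` car (Xs k))"
    using lim by (auto simp: direct_limit_def)
  have lift: "\<exists>y\<in>car (Xs l). \<iota> l y = \<iota> k x \<and> S l y = S k x" if "k \<le> l" "x \<in> car (Xs k)" for k l x
    using that
  proof (induction l rule: dec_induct)
    case (step l)
    then show ?case
      using T ST \<iota>T by metis
  qed blast
  define C where "C = {(\<iota> k x, S k x) | k x. x \<in> car (Xs k)}"
  have "fst ` C = (\<Union>k. \<iota> k ` car (Xs k))"
    by (force simp: C_def)
  then have dC: "dense_in L (fst ` C)"
    using dense by simp
  have sub: "C \<subseteq> car L \<times> car K"
    using ip_preservingD(1)[OF \<iota>] ip_preservingD(1)[OF S] by (auto simp: C_def)
  have iso: "ip L (fst p) (fst q) = ip K (snd p) (snd q)" if pq: "p \<in> C" "q \<in> C" for p q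
  proof -
    obtain k x l y where *: "p = (\<iota> k x, S k x)" "x \<in> car (Xs k)" "q = (\<iota> l y, S l y)" "y \<in> car (Xs l)"
      using pq unfolding C_def by blast
    obtain x' where x': "x' \<in> car (Xs (max k l))" "p = (\<iota> (max k l) x', S (max k l) x')"
      using lift[of k "max k l" x] * by auto
    obtain y' where y': "y' \<in> car (Xs (max k l))" "q = (\<iota> (max k l) y', S (max k l) y')"
      using lift[of l "max k l" y] * by auto
    show ?thesis
      using ip_preservingD(2)[OF \<iota> x'(1) y'(1)] ip_preservingD(2)[OF S x'(1) y'(1)]
      by (simp add: x'(2) y'(2))
  qed
  obtain F where F: "ip_preserving L K F" "\<And>p. p \<in> C \<Longrightarrow> F (fst p) = snd p"
    using isometric_relation_extension[OF L K sub iso dC] by metis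
  have "F (\<iota> k x) = S k x" if "x \<in> car (Xs k)" for k x
    using F(2)[of "(\<iota> k x, S k x)"] that by (auto simp: C_def)
  then show thesis
    using that F(1) by blast
qed

section \<open>Tensor powers of a correspondence with a filter\<close>

locale filter_powers =
  fixes M :: "('a::unital_cstar_algebra, 'm::ab_group_add) corr"
    and P :: "('a, 'm, 't::ab_group_add) powers"
    and m :: 'm and T :: "nat \<Rightarrow> 't \<Rightarrow> 't"
  assumes M: "correspondence M" and essential_M: "essential M" and powers: "tensor_powers M P"
    and filter: "filter_in M m"
    and T_zero: "T 0 (scal P a) = vec P (ract M m a)"
    and T_pos: "k \<ge> 1 \<Longrightarrow> n \<in> car (pow P k) \<Longrightarrow> T k n = mul P 1 k (vec P m) n"
begin

lemma pow_correspondence: "correspondence (pow P k)"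
  using powers by (simp add: tensor_powers_def)

lemma pow_hilbert: "hilbert_module (pow P k)"
  using pow_correspondence by (simp add: correspondence_def)

lemma M_hilbert: "hilbert_module M"
  using M by (simp add: correspondence_def)

lemma scal_iso: "hm_iso alg_module (pow P 0) (scal P)"
  and scal_lact: "scal P (a * b) = lact (pow P 0) a (scal P b)"
  and vec_iso: "hm_iso M (pow P 1) (vec P)"
  and vec_lact: "n \<in> car M \<Longrightarrow> vec P (lact M a n) = lact (pow P 1) a (vec P n)"
  using powers by (simp_all add: tensor_powers_def)

lemma mul_tensor: "tensor_product (pow P k) (pow P l) (pow P (k + l)) (mul P k l)"
  using powers by (intro tensor_productI pow_hilbert pow_correspondence) (simp add: tensor_powers_def)

lemma lact_mul: "x \<in> car (pow P k) \<Longrightarrow> y \<in> car (pow P l) \<Longrightarrow>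
    lact (pow P (k + l)) a (mul P k l x y) = mul P k l (lact (pow P k) a x) y"
  and mul_scal_right: "x \<in> car (pow P k) \<Longrightarrow> mul P k 0 x (scal P a) = ract (pow P k) x a"
  and mul_assoc: "x \<in> car (pow P k) \<Longrightarrow> y \<in> car (pow P l) \<Longrightarrow> z \<in> car (pow P p) \<Longrightarrow>
    mul P (k + l) p (mul P k l x y) z = mul P k (l + p) x (mul P l p y z)"
  using powers by (simp_all add: tensor_powers_def)

lemma mul_one_tensor: "tensor_product (pow P 1) (pow P k) (pow P (Suc k)) (mul P 1 k)"
  using mul_tensor[of 1 k] by simp

lemma mul_vec_tensor: "tensor_product (pow P k) M (pow P (k + 1)) (\<lambda>x n. mul P k 1 x (vec P n))"
proof (rule tensor_productI[OF pow_hilbert M internal_tensor_cong_right[OF _ vec_iso vec_lact]])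
  show "internal_tensor (pow P k) (pow P 1) (pow P (k + 1)) (mul P k 1)"
    by (rule tensor_product.tensor[OF mul_tensor])
qed (auto intro: correspondence.lact_closed[OF M])

lemma scalE:
  assumes "x \<in> car (pow P 0)"
  obtains a where "x = scal P a"
  using assms scal_iso by (auto simp: hm_iso_def alg_module_def)

lemma scal_closed: "scal P a \<in> car (pow P 0)"
  using scal_iso by (auto simp: hm_iso_def alg_module_def)

lemma vec_closed: "n \<in> car M \<Longrightarrow> vec P n \<in> car (pow P 1)"
  using vec_iso by (simp add: hm_iso_def ip_preserving_def)

text \<open>The algebra acts on a higher power through its first tensor factor, which lies in a copy
  of \<open>M\<close>; elementary tensors generate.\<close>

lemma essential_pow: "essential (pow P k)"
proof (cases k)
  case 0
  have "lact (pow P 0) 1 x = x" if "x \<in> car (pow P 0)" for x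
    using scalE[OF that] scal_lact[of 1] by (metis mult_1_left)
  then show ?thesis
    by (simp add: 0 essential_def)
next
  case (Suc j)
  interpret tensor_product "pow P 1" "pow P j" "pow P (Suc j)" "mul P 1 j"
    by (rule mul_one_tensor)
  have "lact (pow P 1) 1 x = x" if "x \<in> car (pow P 1)" for x
  proof -
    have "x \<in> vec P ` car M"
      using that vec_iso by (simp add: hm_iso_def)
    then obtain n where "n \<in> car M" "x = vec P n"
      by blast
    then show ?thesis
      using vec_lact[of n 1] essential_M by (simp add: essential_def)
  qed
  note lact_one = this
  have "lact (pow P (Suc j)) 1 z = z"
    if z: "z \<in> {mul P 1 j x y | x y. x \<in> car (pow P 1) \<and> y \<in> car (pow P j)}" for z
  proof -
    obtain x y where xy: "z = mul P 1 j x y" "x \<in> car (pow P 1)" "y \<in> car (pow P j)"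
      using z by blast
    show ?thesis
      using lact_mul[OF xy(2,3), of 1] by (simp only: xy(1) lact_one[OF xy(2)] plus_1_eq_Suc)
  qed
  then show ?thesis
    unfolding Suc
    by (rule correspondence.essential_if_generates[OF pow_correspondence generates_elementary])
qed

lemma m_closed: "m \<in> car M" and ip_m: "ip M m m = 1"
  using filter by (auto simp: filter_in_def)

lemma ip_vec_m: "ip (pow P 1) (vec P m) (vec P m) = 1"
  using vec_iso ip_preservingD(2)[of M "pow P 1" "vec P" m m] m_closed ip_m by (simp add: hm_iso_def)

text \<open>Under the identification of \<open>M \<otimes> A\<close> with \<open>M\<close> the
  vector \<open>m \<otimes> a\<close> is \<open>m\<close> times \<open>a\<close>, so level 0 needs
  no separate treatment from here on.\<close>

lemma T_eq:
  assumes "n \<in> car (pow P k)"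
  shows "T k n = mul P 1 k (vec P m) n"
proof (cases "k = 0")
  case True
  then obtain a where "n = scal P a"
    using assms scalE by blast
  then show ?thesis
    using True mul_scal_right[OF vec_closed[OF m_closed]] vec_iso
      ip_preserving_ract[OF M_hilbert pow_hilbert _ m_closed, of 1 "vec P"]
    by (simp add: T_zero hm_iso_def)
next
  case False
  then show ?thesis
    using assms by (intro T_pos) auto
qed

lemma T_closed: "n \<in> car (pow P k) \<Longrightarrow> T k n \<in> car (pow P (Suc k))"
  using tensor_product.tensor_closed[OF mul_one_tensor vec_closed[OF m_closed]] by (simp add: T_eq)

lemma T_ip_preserving: "ip_preserving (pow P k) (pow P (Suc k)) (T k)"
  using tensor_product.tensor_left_ip_preserving[OF mul_one_tensor essential_pow vec_closed[OF m_closed] ip_vec_m]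
  by (simp add: ip_preserving_def T_eq)

lemma T_complemented: "complemented (pow P (Suc k)) (T k ` car (pow P k))"
  using tensor_product.complemented_tensor_left[OF mul_one_tensor essential_pow vec_closed[OF m_closed] ip_vec_m, of k]
  by (simp add: T_eq cong: image_cong)

text \<open>\<open>T\<close> acts at the left end and therefore commutes with tensoring on the
  right. This makes the maps \<open>iota_id k\<close> compatible with \<open>T\<close>.\<close>

lemma T_mul:
  assumes "x \<in> car (pow P k)" "y \<in> car (pow P l)"
  shows "T (k + l) (mul P k l x y) = mul P (Suc k) l (T k x) y"
  using mul_assoc[OF vec_closed[OF m_closed] assms] assms
    tensor_product.tensor_closed[OF mul_tensor assms]
  by (simp add: T_eq)

end

section \<open>The direct limit and its refinement isomorphism\<close>

locale filter_limit = filter_powers M P m T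
  for M :: "('a::unital_cstar_algebra, 'm::ab_group_add) corr"
    and P :: "('a, 'm, 't::ab_group_add) powers"
    and m :: 'm and T :: "nat \<Rightarrow> 't \<Rightarrow> 't" +
  fixes L :: "('a, 'l::ab_group_add) hmod" and \<iota> :: "nat \<Rightarrow> 't \<Rightarrow> 'l"
    and LM :: "('a, 'q::ab_group_add) hmod" and \<tau> :: "'l \<Rightarrow> 'm \<Rightarrow> 'q"
  assumes limit: "direct_limit (pow P) T L \<iota>" and LM: "internal_tensor L M LM \<tau>"
begin

lemma L_hilbert: "hilbert_module L" and \<iota>_ip_preserving: "ip_preserving (pow P k) L (\<iota> k)"
  and \<iota>_T: "x \<in> car (pow P k) \<Longrightarrow> \<iota> (Suc k) (T k x) = \<iota> k x"
  and dense_\<iota>: "dense_in L (\<Union>k. \<iota> k ` car (pow P k))"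
  using limit unfolding direct_limit_def by blast+

lemma LM_tensor: "tensor_product L M LM \<tau>"
  by (rule tensor_productI[OF L_hilbert M LM])

lemma LM_hilbert: "hilbert_module LM"
  using LM by (simp add: internal_tensor_def)

abbreviation iota_id :: "nat \<Rightarrow> 't \<Rightarrow> 'q" where
  "iota_id k \<equiv> tensor_id (pow P k) M (pow P (k + 1)) (\<lambda>x n. mul P k 1 x (vec P n)) (\<iota> k) LM \<tau>"

lemma iota_id_ip_preserving: "ip_preserving (pow P (k + 1)) LM (iota_id k)"
  by (rule tensor_product.ip_preserving_tensor_id[OF mul_vec_tensor LM \<iota>_ip_preserving])

lemma iota_id_mul:
  "x \<in> car (pow P k) \<Longrightarrow> n \<in> car M \<Longrightarrow> iota_id k (mul P k 1 x (vec P n)) = \<tau> (\<iota> k x) n"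
  by (rule tensor_product.tensor_id_tensor[OF mul_vec_tensor LM \<iota>_ip_preserving])

lemma iota_id_T:
  assumes "z \<in> car (pow P (k + 1))"
  shows "iota_id (Suc k) (T (k + 1) z) = iota_id k z"
proof -
  interpret tensor_product "pow P k" M "pow P (k + 1)" "\<lambda>x n. mul P k 1 x (vec P n)"
    by (rule mul_vec_tensor)
  have "(iota_id (Suc k) \<circ> T (k + 1)) z = iota_id k z"
  proof (rule ip_preserving_eqI[OF pow_hilbert LM_hilbert _ iota_id_ip_preserving generates_elementary _ assms])
    show "ip_preserving (pow P (k + 1)) LM (iota_id (Suc k) \<circ> T (k + 1))"
      using ip_preserving_comp[OF T_ip_preserving[of "k + 1"], of LM "iota_id (Suc k)"]
        iota_id_ip_preserving[of "Suc k"] by simp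
    show "(iota_id (Suc k) \<circ> T (k + 1)) y = iota_id k y"
      if y: "y \<in> {mul P k 1 x (vec P n) | x n. x \<in> car (pow P k) \<and> n \<in> car M}" for y
    proof -
      obtain x n where xn: "x \<in> car (pow P k)" "n \<in> car M" "y = mul P k 1 x (vec P n)"
        using y by blast
      have "(iota_id (Suc k) \<circ> T (k + 1)) y = iota_id (Suc k) (mul P (Suc k) 1 (T k x) (vec P n))"
        unfolding xn(3) comp_def using T_mul[OF xn(1) vec_closed[OF xn(2)]] by simp
      also have "\<dots> = \<tau> (\<iota> (Suc k) (T k x)) n"
        by (rule iota_id_mul[OF T_closed[OF xn(1)] xn(2)])
      also have "\<dots> = iota_id k y"
        unfolding xn(3) using iota_id_mul[OF xn(1,2)] \<iota>_T[OF xn(1)] by simp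
      finally show ?thesis .
    qed
  qed
  then show ?thesis
    by simp
qed

lemma refinement_iso:
  obtains R where "hm_iso L LM R" "\<And>k n. n \<in> car (pow P (k + 1)) \<Longrightarrow> R (\<iota> (k + 1) n) = iota_id k n"
proof -
  \<comment> \<open>The index shifts by one since \<open>R\<close> splits off the last factor. Level
    0 has no factor to split off, so it is first moved to level 1.\<close>
  define S where "S k = (case k of 0 \<Rightarrow> iota_id 0 \<circ> T 0 | Suc j \<Rightarrow> iota_id j)" for k
  have S_Suc: "S (Suc k) = iota_id k" for k
    by (simp add: S_def)
  have "ip_preserving (pow P k) LM (S k)" for k
  proof (cases k)
    case 0
    then show ?thesis
      using ip_preserving_comp[OF T_ip_preserving[of 0], of LM "iota_id 0"] iota_id_ip_preserving[of 0]
      by (simp add: S_def)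
  next
    case (Suc j)
    then show ?thesis
      using iota_id_ip_preserving[of j] by (simp add: S_Suc)
  qed
  moreover have "S (Suc k) (T k x) = S k x" if "x \<in> car (pow P k)" for k x
  proof (cases k)
    case (Suc j)
    then show ?thesis
      using iota_id_T[of x j] that by (simp add: S_Suc)
  qed (simp add: S_def)
  ultimately obtain R where R: "ip_preserving L LM R" "\<And>k x. x \<in> car (pow P k) \<Longrightarrow> R (\<iota> k x) = S k x"
    using direct_limit_universal[OF limit LM_hilbert T_closed, of S] by metis
  have R_iota: "R (\<iota> (k + 1) n) = iota_id k n" if "n \<in> car (pow P (k + 1))" for k n
    using R(2)[OF that] S_Suc by simp
  have "hm_iso L LM R"
  proof (rule hm_isoI[OF L_hilbert LM_hilbert R(1)])
    \<comment> \<open>The vectors \<open>\<iota> k x\<close> generate \<open>L\<close>, so their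
      tensors with \<open>M\<close> generate the target; each of them is the image of a product at
      level \<open>k + 1\<close>.\<close>
    show "generates LM {\<tau> x n | x n. x \<in> (\<Union>k. \<iota> k ` car (pow P k)) \<and> n \<in> car M}"
      by (rule tensor_product.generates_tensor[OF LM_tensor dense_in_generates[OF dense_\<iota>]])
    show "{\<tau> x n | x n. x \<in> (\<Union>k. \<iota> k ` car (pow P k)) \<and> n \<in> car M} \<subseteq> R ` car L"
    proof clarify
      fix k x n assume xn: "x \<in> car (pow P k)" "n \<in> car M"
      then have c: "mul P k 1 x (vec P n) \<in> car (pow P (k + 1))"
        by (rule tensor_product.tensor_closed[OF mul_vec_tensor])
      then have "R (\<iota> (k + 1) (mul P k 1 x (vec P n))) = \<tau> (\<iota> k x) n"
        using R_iota iota_id_mul[OF xn] by simp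
      then show "\<tau> (\<iota> k x) n \<in> R ` car L"
        using ip_preservingD(1)[OF \<iota>_ip_preserving c] by (metis imageI)
    qed
  qed
  then show thesis
    using that R_iota by blast
qed

end

section \<open>The powers of a scaling isomorphism\<close>

locale scaling = filter_powers M P m T
  for M :: "('a::unital_cstar_algebra, 'm::ab_group_add) corr"
    and P :: "('a, 'm, 't::ab_group_add) powers"
    and m :: 'm and T :: "nat \<Rightarrow> 't \<Rightarrow> 't" +
  fixes X :: "('a, 'x::ab_group_add) hmod"
    and W :: "('a, 'x, 't, 'y::ab_group_add) amplification"
    and D :: "'x \<Rightarrow> 'y" and \<phi> :: 'x
  assumes amplification: "tensor_amplification P X W" and scaling: "scaling_function P m X W D \<phi>"
begin

lemma X_hilbert: "hilbert_module X" and D_iso: "hm_iso X (amp W 1) D"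
  and \<phi>_closed: "\<phi> \<in> car X" and ip_\<phi>: "ip X \<phi> \<phi> = 1" and D_\<phi>: "D \<phi> = elt W 1 \<phi> (vec P m)"
  using scaling by (simp_all add: scaling_function_def)

lemma emb_iso: "hm_iso X (amp W 0) (emb W)"
  and ten_scal: "x \<in> car (amp W l) \<Longrightarrow> ten W l 0 x (scal P a) = ract (amp W l) x a"
  and ten_mul: "x \<in> car (amp W l) \<Longrightarrow> n \<in> car (pow P k) \<Longrightarrow> n' \<in> car (pow P p) \<Longrightarrow>
    ten W (l + k) p (ten W l k x n) n' = ten W l (k + p) x (mul P k p n n')"
  and ten_internal: "internal_tensor (amp W l) (pow P k) (amp W (l + k)) (ten W l k)"
  using amplification by (simp_all add: tensor_amplification_def)

lemma amp_hilbert: "hilbert_module (amp W k)"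
  using ten_internal[of k 0] by (simp add: internal_tensor_def)

lemma ten_tensor: "tensor_product (amp W l) (pow P k) (amp W (l + k)) (ten W l k)"
  by (rule tensor_productI[OF amp_hilbert pow_correspondence ten_internal])

lemma ten_one_tensor: "tensor_product (amp W 1) (pow P k) (amp W (Suc k)) (ten W 1 k)"
  using ten_tensor[of 1 k] by simp

lemma elt_tensor: "tensor_product X (pow P k) (amp W k) (elt W k)"
proof (rule tensor_productI[OF X_hilbert pow_correspondence])
  show "internal_tensor X (pow P k) (amp W k) (elt W k)"
    using internal_tensor_cong_left[OF ten_internal[of 0 k] emb_iso] by (simp add: elt_def[abs_def])
qed

lemma elt_vec_internal: "internal_tensor X M (amp W 1) (\<lambda>x n. elt W 1 x (vec P n))"
  by (rule internal_tensor_cong_right[OF tensor_product.tensor[OF elt_tensor] vec_iso vec_lact])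
    (auto intro: correspondence.lact_closed[OF M])

lemma emb_closed: "x \<in> car X \<Longrightarrow> emb W x \<in> car (amp W 0)"
  and D_closed: "x \<in> car X \<Longrightarrow> D x \<in> car (amp W 1)"
  using emb_iso D_iso by (simp_all add: hm_iso_def ip_preserving_def)

lemma elt_closed: "x \<in> car X \<Longrightarrow> n \<in> car (pow P k) \<Longrightarrow> elt W k x n \<in> car (amp W k)"
  by (rule tensor_product.tensor_closed[OF elt_tensor])

lemma ten_elt:
  assumes "x \<in> car X" "n \<in> car (pow P k)" "n' \<in> car (pow P l)"
  shows "ten W k l (elt W k x n) n' = elt W (k + l) x (mul P k l n n')"
  using ten_mul[OF emb_closed[OF assms(1)] assms(2,3)] by (simp add: elt_def)

text \<open>The factor \<open>D \<otimes> id\<close> of the powers of \<open>D\<close>, including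
  \<open>k = 0\<close>, which reduces the three clauses of \<open>dpow\<close> to a single
  recursion.\<close>

definition step :: "nat \<Rightarrow> 'y \<Rightarrow> 'y" where
  "step k = tensor_id X (pow P k) (amp W k) (elt W k) D (amp W (Suc k)) (ten W 1 k)"

lemma step_ip_preserving: "ip_preserving (amp W k) (amp W (Suc k)) (step k)"
  and step_elt: "x \<in> car X \<Longrightarrow> n \<in> car (pow P k) \<Longrightarrow> step k (elt W k x n) = ten W 1 k (D x) n"
proof -
  have D: "ip_preserving X (amp W 1) D"
    using D_iso by (simp add: hm_iso_def)
  note props = tensor_product.tensor_id_props[OF elt_tensor tensor_product.tensor[OF ten_one_tensor] D]
  show "ip_preserving (amp W k) (amp W (Suc k)) (step k)"
    unfolding step_def by (rule props)
  show "x \<in> car X \<Longrightarrow> n \<in> car (pow P k) \<Longrightarrow> step k (elt W k x n) = ten W 1 k (D x) n"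
    unfolding step_def by (rule props)
qed

lemma step_iso: "hm_iso (amp W k) (amp W (Suc k)) (step k)"
proof (rule hm_isoI[OF amp_hilbert amp_hilbert step_ip_preserving])
  show "generates (amp W (Suc k)) {ten W 1 k y n | y n. y \<in> car (amp W 1) \<and> n \<in> car (pow P k)}"
    by (rule tensor_product.generates_elementary[OF ten_one_tensor])
  show "{ten W 1 k y n | y n. y \<in> car (amp W 1) \<and> n \<in> car (pow P k)} \<subseteq> step k ` car (amp W k)"
  proof clarify
    fix y n assume y: "y \<in> car (amp W 1)" and n: "n \<in> car (pow P k)"
    have "y \<in> D ` car X"
      using y D_iso by (simp add: hm_iso_def)
    then obtain x where x: "x \<in> car X" "y = D x"
      by blast
    then show "ten W 1 k y n \<in> step k ` car (amp W k)"
      using step_elt[OF x(1) n] elt_closed[OF x(1) n] by (metis imageI)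
  qed
qed

lemma elt_zero: "x \<in> car X \<Longrightarrow> elt W 0 x (scal P a) = emb W (ract X x a)"
  using ten_scal[OF emb_closed] ip_preserving_ract[OF X_hilbert amp_hilbert _, of 0 "emb W" x a] emb_iso
  by (simp add: elt_def hm_iso_def)

lemma dpow_Suc:
  assumes "x \<in> car X"
  shows "dpow P X W D (Suc k) x = step k (dpow P X W D k x)"
proof (cases k)
  case 0
  \<comment> \<open>Writing \<open>x\<close> as \<open>x \<otimes> 1\<close> shows that
    \<open>D \<otimes> id\<close> on the amplification 0 is \<open>D\<close> itself.\<close>
  have "emb W x = elt W 0 x (scal P 1)"
    using elt_zero[OF assms, of 1] assms by (simp add: hilbert_module.ract_one[OF X_hilbert])
  then have "step 0 (emb W x) = ten W 1 0 (D x) (scal P 1)"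
    using step_elt[OF assms scal_closed] by simp
  also have "\<dots> = D x"
    using ten_scal[OF D_closed[OF assms]] hilbert_module.ract_one[OF amp_hilbert D_closed[OF assms]] by simp
  finally show ?thesis
    by (simp add: 0)
qed (simp add: step_def)

lemma dpow_iso: "hm_iso X (amp W k) (dpow P X W D k)"
proof (induction k)
  case (Suc k)
  from hm_iso_comp[OF Suc step_iso] show ?case
    by (rule hm_iso_cong) (simp add: dpow_Suc)
qed (simp add: emb_iso)

lemma dpow_closed: "x \<in> car X \<Longrightarrow> dpow P X W D k x \<in> car (amp W k)"
  using dpow_iso[of k] by (simp add: hm_iso_def ip_preserving_def)

lemma dpow_inj: "x \<in> car X \<Longrightarrow> y \<in> car X \<Longrightarrow> dpow P X W D k x = dpow P X W D k y \<Longrightarrow> x = y"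
  using ip_preserving_inj_on[OF X_hilbert amp_hilbert, of k "dpow P X W D k"] dpow_iso[of k]
  by (auto simp: hm_iso_def inj_on_def)

text \<open>Both sides are isometries in \<open>ten W k l w n\<close>, and on the generators
  \<open>x \<otimes> n0 \<otimes> n\<close> they agree by associativity.\<close>

lemma step_ten:
  assumes w: "w \<in> car (amp W k)" and n: "n \<in> car (pow P l)"
  shows "step (k + l) (ten W k l w n) = ten W (Suc k) l (step k w) n"
proof -
  interpret tensor_product "amp W k" "pow P l" "amp W (k + l)" "ten W k l"
    by (rule ten_tensor)
  have int: "internal_tensor (amp W (Suc k)) (pow P l) (amp W (Suc (k + l))) (ten W (Suc k) l)"
    using ten_internal[of "Suc k" l] by simp
  let ?G = "tensor_id (amp W k) (pow P l) (amp W (k + l)) (ten W k l) (step k)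
    (amp W (Suc (k + l))) (ten W (Suc k) l)"
  have G: "ip_preserving (amp W (k + l)) (amp W (Suc (k + l))) ?G"
    and G_ten: "\<And>w n. w \<in> car (amp W k) \<Longrightarrow> n \<in> car (pow P l) \<Longrightarrow>
      ?G (ten W k l w n) = ten W (Suc k) l (step k w) n"
    using tensor_id_props[OF int step_ip_preserving] by blast+
  let ?S = "{elt W k x n | x n. x \<in> car X \<and> n \<in> car (pow P k)}"
  have "step (k + l) (ten W k l w n) = ?G (ten W k l w n)"
  proof (rule ip_preserving_eqI[OF amp_hilbert amp_hilbert step_ip_preserving G])
    show "generates (amp W (k + l)) {ten W k l w n | w n. w \<in> ?S \<and> n \<in> car (pow P l)}"
      by (rule generates_tensor[OF tensor_product.generates_elementary[OF elt_tensor]])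
    show "step (k + l) z = ?G z" if z: "z \<in> {ten W k l w n | w n. w \<in> ?S \<and> n \<in> car (pow P l)}" for z
    proof -
      obtain x n0 n where *: "z = ten W k l (elt W k x n0) n" "x \<in> car X" "n0 \<in> car (pow P k)" "n \<in> car (pow P l)"
        using z by blast
      have c: "mul P k l n0 n \<in> car (pow P (k + l))"
        by (rule tensor_product.tensor_closed[OF mul_tensor *(3,4)])
      have "step (k + l) z = ten W 1 (k + l) (D x) (mul P k l n0 n)"
        unfolding *(1) ten_elt[OF *(2-4)] by (rule step_elt[OF *(2) c])
      also have "\<dots> = ten W (Suc k) l (ten W 1 k (D x) n0) n"
        using ten_mul[OF D_closed[OF *(2)] *(3,4)] by simp
      also have "\<dots> = ?G z"
        unfolding *(1) G_ten[OF elt_closed[OF *(2,3)] *(4)] step_elt[OF *(2,3)] ..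
      finally show ?thesis .
    qed
  qed (rule tensor_closed[OF w n])
  then show ?thesis
    using G_ten[OF w n] by simp
qed

text \<open>\<open>dpow\<close> is defined by \<open>D\<^bsup>k+1\<^esup> = (D \<otimes> id) \<circ> D\<^bsup>k\<^esup>\<close>; this is
  \<open>D\<^bsup>k+1\<^esup> = (D\<^bsup>k\<^esup> \<otimes> id) \<circ> D\<close>.\<close>

lemma dpow_Suc':
  assumes y: "y \<in> car X" and x: "x \<in> car X" and n: "n \<in> car (pow P 1)" and D: "D y = elt W 1 x n"
  shows "dpow P X W D (Suc k) y = ten W k 1 (dpow P X W D k x) n"
proof (induction k)
  case 0
  then show ?case
    using D by (simp add: elt_def)
next
  case (Suc k)
  have "dpow P X W D (Suc (Suc k)) y = step (k + 1) (ten W k 1 (dpow P X W D k x) n)"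
    unfolding dpow_Suc[OF y, of "Suc k"] Suc by simp
  also have "\<dots> = ten W (Suc k) 1 (dpow P X W D (Suc k) x) n"
    using step_ten[OF dpow_closed[OF x] n] dpow_Suc[OF x] by simp
  finally show ?case .
qed

section \<open>The isometries of the powers of \<open>M\<close> into \<open>X\<close>\<close>

definition level :: "nat \<Rightarrow> 't \<Rightarrow> 'x" where
  "level k n = inv_into (car X) (dpow P X W D k) (elt W k \<phi> n)"

lemma level_ip_preserving: "ip_preserving (pow P k) X (level k)"
proof -
  have "ip_preserving (pow P k) (amp W k) (elt W k \<phi>)"
    by (rule tensor_product.tensor_left_ip_preserving[OF elt_tensor essential_pow \<phi>_closed ip_\<phi>])
  moreover have "ip_preserving (amp W k) X (inv_into (car X) (dpow P X W D k))"
    using hm_iso_inv_into[OF X_hilbert amp_hilbert dpow_iso] by (simp add: hm_iso_def)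
  ultimately have "ip_preserving (pow P k) X (inv_into (car X) (dpow P X W D k) \<circ> elt W k \<phi>)"
    by (rule ip_preserving_comp)
  then show ?thesis
    by (simp add: level_def[abs_def] comp_def)
qed

lemma level_closed: "n \<in> car (pow P k) \<Longrightarrow> level k n \<in> car X"
  by (rule ip_preservingD[OF level_ip_preserving])

lemma dpow_level:
  assumes "n \<in> car (pow P k)"
  shows "dpow P X W D k (level k n) = elt W k \<phi> n"
  unfolding level_def
  by (rule f_inv_into_f) (use dpow_iso[of k] elt_closed[OF \<phi>_closed assms] in \<open>simp add: hm_iso_def\<close>)

lemma level_eqI:
  "n \<in> car (pow P k) \<Longrightarrow> x \<in> car X \<Longrightarrow> dpow P X W D k x = elt W k \<phi> n \<Longrightarrow> level k n = x"
  by (rule dpow_inj[of _ _ k]) (simp_all add: dpow_level level_closed)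

text \<open>Apply the power \<open>k + 1\<close> of \<open>D\<close> to \<open>level k n\<close>
  with \<open>D \<otimes> id\<close> acting last: \<open>\<phi> \<otimes> n\<close> becomes
  \<open>\<phi> \<otimes> m \<otimes> n\<close>.\<close>

lemma level_T:
  assumes "n \<in> car (pow P k)"
  shows "level (Suc k) (T k n) = level k n"
proof (rule level_eqI[OF T_closed[OF assms] level_closed[OF assms]])
  have "dpow P X W D (Suc k) (level k n) = ten W 1 k (elt W 1 \<phi> (vec P m)) n"
    using step_elt[OF \<phi>_closed assms] by (simp only: dpow_Suc[OF level_closed[OF assms]] dpow_level[OF assms] D_\<phi>)
  also have "\<dots> = elt W (Suc k) \<phi> (T k n)"
    using ten_elt[OF \<phi>_closed vec_closed[OF m_closed] assms] by (simp add: T_eq[OF assms])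
  finally show "dpow P X W D (Suc k) (level k n) = elt W (Suc k) \<phi> (T k n)" .
qed

lemma level_scal: "level 0 (scal P a) = ract X \<phi> a"
  by (rule level_eqI[OF scal_closed])
    (simp_all add: elt_zero[OF \<phi>_closed] hilbert_module.ract_closed[OF X_hilbert \<phi>_closed])

text \<open>The relation between \<open>D\<close>, \<open>Q\<close> and \<open>R\<close> at a finite
  level. Take the preimage \<open>y\<close> under \<open>D\<close> of
  \<open>level k x \<otimes> n\<close>; with \<open>D\<close> acting first, the power
  \<open>k + 1\<close> of \<open>D\<close> sends \<open>y\<close> to
  \<open>\<phi> \<otimes> x \<otimes> n\<close>, which identifies \<open>y\<close>.\<close>

lemma D_level_mul:
  assumes x: "x \<in> car (pow P k)" and n: "n \<in> car (pow P 1)"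
  shows "D (level (k + 1) (mul P k 1 x n)) = elt W 1 (level k x) n"
proof -
  have "elt W 1 (level k x) n \<in> D ` car X"
    using elt_closed[OF level_closed[OF x] n] D_iso by (simp add: hm_iso_def)
  then obtain y where y: "y \<in> car X" "D y = elt W 1 (level k x) n"
    by force
  have "dpow P X W D (k + 1) y = ten W k 1 (elt W k \<phi> x) n"
    using dpow_Suc'[OF y(1) level_closed[OF x] n y(2)] by (simp add: dpow_level[OF x])
  also have "\<dots> = elt W (k + 1) \<phi> (mul P k 1 x n)"
    by (rule ten_elt[OF \<phi>_closed x n])
  finally have "level (k + 1) (mul P k 1 x n) = y"
    by (rule level_eqI[OF tensor_product.tensor_closed[OF mul_tensor x n] y(1)])
  then show ?thesis
    using y(2) by simp
qed

text \<open>Balancedness moves the coefficient in \<open>ract X \<phi> a\<close> to the right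
  factor, so the elementary tensors in question are the vectors \<open>\<phi> \<otimes> n\<close>.
  These already form a closed submodule, being an isometric image, so span and closure add
  nothing.\<close>

lemma sub_tensor_level:
  assumes V: "V = range (ract X \<phi>)"
  shows "inv_into (car X) (dpow P X W D k) ` sub_tensor P W V k = level k ` car (pow P k)"
proof -
  interpret tensor_product X "pow P k" "amp W k" "elt W k"
    by (rule elt_tensor)
  let ?S = "{elt W k v n | v n. v \<in> V \<and> n \<in> car (pow P k)}"
  have "elt W k (ract X \<phi> a) n \<in> elt W k \<phi> ` car (pow P k)" if "n \<in> car (pow P k)" for a n
    using that \<phi>_closed by (simp add: tensor_balanced E.lact_closed)
  then have "?S \<subseteq> elt W k \<phi> ` car (pow P k)"
    using V by auto
  moreover have "closed_submodule (amp W k) (elt W k \<phi> ` car (pow P k))"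
    by (rule closed_submodule_image[OF pow_hilbert amp_hilbert
          tensor_left_ip_preserving[OF essential_pow \<phi>_closed ip_\<phi>]])
  ultimately have "sub_tensor P W V k \<subseteq> elt W k \<phi> ` car (pow P k)"
    unfolding sub_tensor_def by (intro Z.hclosure_hspan_subset)
  moreover have "elt W k \<phi> ` car (pow P k) \<subseteq> sub_tensor P W V k"
  proof -
    have "\<phi> \<in> V"
      using V X.ract_one[OF \<phi>_closed] by (metis rangeI)
    moreover have "?S \<subseteq> car (amp W k)"
      using V \<phi>_closed by (auto intro: tensor_closed X.ract_closed)
    ultimately show ?thesis
      unfolding sub_tensor_def
      using Z.subset_hspan[of ?S] Z.subset_hclosure[OF Z.hspan_subset_car[of ?S]] by blast
  qed
  ultimately have "sub_tensor P W V k = elt W k \<phi> ` car (pow P k)"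
    by blast
  then show ?thesis
    by (simp add: image_image level_def)
qed

end

section \<open>The multi-resolution analysis\<close>

locale scaling_limit = scaling M P m T X W D \<phi> + filter_limit M P m T L \<iota> LM \<tau>
  for M :: "('a::unital_cstar_algebra, 'm::ab_group_add) corr"
    and P :: "('a, 'm, 't::ab_group_add) powers"
    and m :: 'm and T :: "nat \<Rightarrow> 't \<Rightarrow> 't"
    and X :: "('a, 'x::ab_group_add) hmod"
    and W :: "('a, 'x, 't, 'y::ab_group_add) amplification"
    and D :: "'x \<Rightarrow> 'y" and \<phi> :: 'x
    and L :: "('a, 'l::ab_group_add) hmod" and \<iota> :: "nat \<Rightarrow> 't \<Rightarrow> 'l"
    and LM :: "('a, 'q::ab_group_add) hmod" and \<tau> :: "'l \<Rightarrow> 'm \<Rightarrow> 'q"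
begin

lemma limit_embedding:
  obtains Q where "ip_preserving L X Q" "\<And>k n. n \<in> car (pow P k) \<Longrightarrow> Q (\<iota> k n) = level k n"
  using direct_limit_universal[OF limit X_hilbert T_closed level_ip_preserving level_T] by metis

text \<open>The formula for \<open>R\<close> starts at level 1. Nothing is lost by dropping level 0,
  since \<open>T\<close> embeds it in level 1.\<close>

lemma generates_shifted: "generates L (\<Union>k. \<iota> (k + 1) ` car (pow P (k + 1)))"
proof -
  have "(\<Union>k. \<iota> k ` car (pow P k)) \<subseteq> (\<Union>k. \<iota> (k + 1) ` car (pow P (k + 1)))"
  proof clarify
    fix k n assume n: "n \<in> car (pow P k)"
    have "\<iota> k n = \<iota> (k + 1) (T k n)" "T k n \<in> car (pow P (k + 1))"
      using \<iota>_T[OF n] T_closed[OF n] by simp_all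
    then show "\<iota> k n \<in> (\<Union>k. \<iota> (k + 1) ` car (pow P (k + 1)))"
      by blast
  qed
  moreover have "(\<Union>k. \<iota> (k + 1) ` car (pow P (k + 1))) \<subseteq> car L"
    using ip_preservingD(1)[OF \<iota>_ip_preserving] by blast
  ultimately show ?thesis
    using dense_in_generates[OF dense_\<iota>] by (auto simp: generates_def)
qed

context
  fixes R :: "'l \<Rightarrow> 'q" and Q :: "'l \<Rightarrow> 'x"
  assumes R: "hm_iso L LM R" "\<And>k n. n \<in> car (pow P (k + 1)) \<Longrightarrow> R (\<iota> (k + 1) n) = iota_id k n"
    and Q: "ip_preserving L X Q" "\<And>k n. n \<in> car (pow P k) \<Longrightarrow> Q (\<iota> k n) = level k n"
begin

lemma D_Q:
  assumes z: "z \<in> car L"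
  shows "D (Q z) = tensor_id L M LM \<tau> Q (amp W 1) (\<lambda>x n. elt W 1 x (vec P n)) (R z)"
proof -
  let ?G = "tensor_id L M LM \<tau> Q (amp W 1) (\<lambda>x n. elt W 1 x (vec P n))"
  note G = tensor_product.tensor_id_props[OF LM_tensor elt_vec_internal Q(1)]
  have F: "ip_preserving L (amp W 1) (D \<circ> Q)"
    using ip_preserving_comp[OF Q(1)] D_iso by (auto simp: hm_iso_def)
  have GR: "ip_preserving L (amp W 1) (?G \<circ> R)"
    using ip_preserving_comp[OF _ G(1)] R(1) by (auto simp: hm_iso_def)
  \<comment> \<open>Within one level the elementary tensors generate, and both maps send the class
    of \<open>x \<otimes> n\<close> to \<open>level k x \<otimes> n\<close>.\<close>
  have level_eq: "(D \<circ> Q \<circ> \<iota> (k + 1)) w = (?G \<circ> R \<circ> \<iota> (k + 1)) w" if w: "w \<in> car (pow P (k + 1))" for k w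
  proof (rule ip_preserving_eqI[OF pow_hilbert amp_hilbert
        ip_preserving_comp[OF \<iota>_ip_preserving F] ip_preserving_comp[OF \<iota>_ip_preserving GR]
        tensor_product.generates_elementary[OF mul_vec_tensor] _ w])
    fix y assume "y \<in> {mul P k 1 x (vec P n) | x n. x \<in> car (pow P k) \<and> n \<in> car M}"
    then obtain x n where *: "x \<in> car (pow P k)" "n \<in> car M" "y = mul P k 1 x (vec P n)"
      by blast
    have y: "y \<in> car (pow P (k + 1))"
      unfolding *(3) by (rule tensor_product.tensor_closed[OF mul_vec_tensor *(1,2)])
    have "D (Q (\<iota> (k + 1) y)) = elt W 1 (level k x) (vec P n)"
      unfolding Q(2)[OF y] unfolding *(3) by (rule D_level_mul[OF *(1) vec_closed[OF *(2)]])
    also have "\<dots> = ?G (\<tau> (\<iota> k x) n)"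
      using G(2)[OF ip_preservingD(1)[OF \<iota>_ip_preserving *(1)] *(2)] Q(2)[OF *(1)] by simp
    also have "\<dots> = ?G (R (\<iota> (k + 1) y))"
      unfolding R(2)[OF y] unfolding *(3) iota_id_mul[OF *(1,2)] ..
    finally show "(D \<circ> Q \<circ> \<iota> (k + 1)) y = (?G \<circ> R \<circ> \<iota> (k + 1)) y"
      by simp
  qed
  have "(D \<circ> Q) z = (?G \<circ> R) z"
    by (rule ip_preserving_eqI[OF L_hilbert amp_hilbert F GR generates_shifted _ z])
      (use level_eq in auto)
  then show ?thesis
    by simp
qed

lemma Q_iota_image: "Q ` \<iota> k ` car (pow P k) = level k ` car (pow P k)"
  unfolding image_image by (rule image_cong) (simp_all add: Q(2))

lemma level_zero_image: "level 0 ` car (pow P 0) = range (ract X \<phi>)"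
proof -
  have "car (pow P 0) = range (scal P)"
    using scal_iso by (simp add: hm_iso_def alg_module_def)
  then show ?thesis
    by (simp add: image_image level_scal)
qed

lemma range_Q_closed: "closed_submodule X (Q ` car L)"
  by (rule closed_submodule_image[OF L_hilbert X_hilbert Q(1)])

lemma level_in_range: "n \<in> car (pow P k) \<Longrightarrow> level k n \<in> Q ` car L"
  using Q(2) ip_preservingD(1)[OF \<iota>_ip_preserving] by (metis imageI)

lemma mra: "projective_mra P X W D (Q ` car L) (\<lambda>k. Q ` \<iota> k ` car (pow P k))"
  unfolding projective_mra_def Q_iota_image level_zero_image
proof (intro conjI allI)
  let ?N = "X\<lparr>car := Q ` car L\<rparr>"
  have N: "hilbert_module ?N"
    by (rule hilbert_module.hilbert_module_restrict[OF X_hilbert range_Q_closed])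
  \<comment> \<open>The complement of the level 0 module is taken in the range of \<open>Q\<close>,
    not in \<open>X\<close>; hence \<open>level 0\<close> is regarded as a map into
    \<open>?N\<close>.\<close>
  have "ip_preserving (pow P 0) ?N (level 0)"
    using level_ip_preserving[of 0] level_in_range by (simp add: ip_preserving_def)
  from closed_submodule_image[OF pow_hilbert N this]
  have "closed_submodule ?N (range (ract ?N \<phi>))"
    by (simp add: level_zero_image)
  moreover have "\<phi> \<in> car ?N"
    using level_in_range[OF scal_closed[of 1]] hilbert_module.ract_one[OF X_hilbert \<phi>_closed]
    by (simp add: level_scal)
  ultimately show "complemented ?N (range (ract X \<phi>))"
    using hilbert_module.complemented_cyclic[OF N, of \<phi>] ip_\<phi> by simp
  show "level k ` car (pow P k) = inv_into (car X) (dpow P X W D k) ` sub_tensor P W (range (ract X \<phi>)) k"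
    for k
    using sub_tensor_level by simp
  show "complemented (X\<lparr>car := level (Suc k) ` car (pow P (Suc k))\<rparr>) (level k ` car (pow P k))" for k
  proof -
    let ?K = "X\<lparr>car := level (Suc k) ` car (pow P (Suc k))\<rparr>"
    have "hilbert_module ?K"
      by (intro hilbert_module.hilbert_module_restrict[OF X_hilbert]
          closed_submodule_image[OF pow_hilbert X_hilbert] level_ip_preserving)
    moreover have "hm_iso (pow P (Suc k)) ?K (level (Suc k))"
      using level_ip_preserving[of "Suc k"] by (simp add: hm_iso_def ip_preserving_def)
    \<comment> \<open>The inclusion of one level in the next is the image under
      \<open>level (Suc k)\<close> of the inclusion of \<open>T k\<close> applied to the power
      \<open>k\<close>, whose complement comes from \<open>m\<close>.\<close>
    ultimately have "complemented ?K (level (Suc k) ` T k ` car (pow P k))"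
      using T_complemented by (rule complemented_image[OF pow_hilbert])
    then show ?thesis
      by (simp add: image_image level_T cong: image_cong)
  qed
  have "hm_iso L ?N Q"
    using Q(1) by (simp add: hm_iso_def ip_preserving_def)
  from dense_in_image[OF L_hilbert N this dense_\<iota>]
  show "dense_in ?N (\<Union>k. level k ` car (pow P k))"
    by (simp add: image_UN Q_iota_image)
qed

lemma free_generator:
  "hm_iso alg_module (X\<lparr>car := Q ` \<iota> 0 ` car (pow P 0)\<rparr>) (\<lambda>a. ract X \<phi> a)"
proof -
  interpret X: hilbert_module X
    by (rule X_hilbert)
  have "ip X (ract X \<phi> a) (ract X \<phi> b) = star a * b" for a b
    using \<phi>_closed by (simp add: X.ip_ract_left X.ip_ract_right X.ract_closed ip_\<phi>)
  then show ?thesis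
    unfolding Q_iota_image level_zero_image
    by (simp add: hm_iso_def ip_preserving_def alg_module_def)
qed

end

end

theorem corollary2p6:
  fixes M :: "('a::unital_cstar_algebra, 'm::ab_group_add) corr"
    and P :: "('a, 'm, 't::ab_group_add) powers"
    and X :: "('a, 'x::ab_group_add) hmod"
    and W :: "('a, 'x, 't, 'y::ab_group_add) amplification"
    and L :: "('a, 'l::ab_group_add) hmod"
    and LM :: "('a, 'q::ab_group_add) hmod"
    and \<tau> :: "'l \<Rightarrow> 'm \<Rightarrow> 'q"
    and m :: 'm and D :: "'x \<Rightarrow> 'y" and \<phi> :: 'x
    and T :: "nat \<Rightarrow> 't \<Rightarrow> 't" and \<iota> :: "nat \<Rightarrow> 't \<Rightarrow> 'l"
  assumes "correspondence M" and "essential M" and "tensor_powers M P"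
    and "filter_in M m"
    and "tensor_amplification P X W" and "scaling_function P m X W D \<phi>"
    and "\<And>a. T 0 (scal P a) = vec P (ract M m a)"
    and "\<And>k n. k \<ge> 1 \<Longrightarrow> n \<in> car (pow P k) \<Longrightarrow> T k n = mul P 1 k (vec P m) n"
    and "direct_limit (pow P) T L \<iota>"
    and "internal_tensor L M LM \<tau>"
  shows "\<exists>R. hm_iso L LM R \<and>
      (\<forall>k. \<forall>n\<in>car (pow P (k + 1)).
         R (\<iota> (k + 1) n) =
           tensor_id (pow P k) M (pow P (k + 1)) (\<lambda>x n. mul P k 1 x (vec P n)) (\<iota> k) LM \<tau> n) \<and>
      (\<exists>Q. ip_preserving L X Q \<and>
        Q (\<iota> 0 (scal P 1)) = \<phi> \<and>
        (\<forall>z\<in>car L. D (Q z) =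
           tensor_id L M LM \<tau> Q (amp W 1) (\<lambda>x n. elt W 1 x (vec P n)) (R z)) \<and>
        closed_submodule X (Q ` car L) \<and>
        projective_mra P X W D (Q ` car L) (\<lambda>k. Q ` \<iota> k ` car (pow P k)) \<and>
        hm_iso alg_module (X\<lparr>car := Q ` \<iota> 0 ` car (pow P 0)\<rparr>) (\<lambda>a. ract X \<phi> a))"
proof -
  interpret scaling_limit M P m T X W D \<phi> L \<iota> LM \<tau>
    by (intro scaling_limit.intro scaling.intro scaling_axioms.intro filter_limit.intro
        filter_limit_axioms.intro filter_powers.intro assms)
  obtain R where R: "hm_iso L LM R" "\<And>k n. n \<in> car (pow P (k + 1)) \<Longrightarrow> R (\<iota> (k + 1) n) = iota_id k n"
    by (rule refinement_iso) (rule that)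
  obtain Q where Q: "ip_preserving L X Q" "\<And>k n. n \<in> car (pow P k) \<Longrightarrow> Q (\<iota> k n) = level k n"
    by (rule limit_embedding) (rule that)
  have "Q (\<iota> 0 (scal P 1)) = \<phi>"
    using Q(2)[OF scal_closed, of 1] by (simp add: level_scal hilbert_module.ract_one[OF X_hilbert \<phi>_closed])
  then show ?thesis
    using R Q D_Q[OF R Q] range_Q_closed[OF R Q] mra[OF R Q] free_generator[OF R Q]
    by (intro exI[of _ R] conjI exI[of _ Q] allI ballI)
qed

end
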